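(* Let $f$ be a locally integrable function on $\mathbb{R}^n$ and let $w$ be a weight on $\mathbb{R}^n$. Then for every cube $Q\subset\mathbb{R}^n$, every $1\le p<\infty$ and every $1<r<\infty$, \[ \left(\frac{1}{w_r(Q)}\int_Q\left(\frac{M_Q(f-f_Q)(x)}{M^\sharp f(x)}\right)^p w(x)\,dx\right)^{1/p}\le c_n\,p\,r', \] where $c_n$ depends only on $n$ and $r'=r/(r-1)$. Consequently, if moreover $w\in A_\infty$, then for every cube $Q$ and every $1\le p<\infty$, \[ \left(\frac{1}{w(Q)}\int_Q\left(\frac{M_Q(f-f_Q)(x)}{M^\sharp f(x)}\right)^p w(x)\,dx\right)^{1/p}\le c_n\,p\,[w]_{A_\infty}. \]
   Context: A weight is a non-negative locally integrable function; $w(E)=\int_E w$. For a cube $Q$, $f_Q=\frac{1}{|Q|}\int_Q f$. For $r>1$, $w_r(Q)=|Q|\left(\frac{1}{|Q|}\int_Q w^r\right)^{1/r}$. The sharp maximal function is $M^\sharp f(x)=\sup_{R\ni x}\frac{1}{|R|}\int_R|f-f_R|$, the supremum over all cubes $R$ containing $x$. For a cube $Q$, $\mathcal D(Q)$ is the collection of dyadic descendants of $Q$ (obtained by repeatedly bisecting sides), and the localized dyadic maximal operator is $M_Qh(x)=\sup_{R\in\mathcal D(Q),\,x\in R}\frac{1}{|R|}\int_R|h|$. $M$ denotes the Hardy–Littlewood maximal operator over cubes, and $[w]_{A_\infty}=\sup_Q\frac{\int_Q M(w\mathbf 1_Q)}{w(Q)}$; $w\in A_\infty$ means $[w]_{A_\infty}<\infty$.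 *)

theory Defs
  imports "HOL-Analysis.Analysis"
begin

definition cube :: "real^'n \<Rightarrow> real \<Rightarrow> (real^'n) set" where
  "cube a h = cbox a (a + h *\<^sub>R One)"

definition is_cube :: "(real^'n) set \<Rightarrow> bool" where
  "is_cube Q \<longleftrightarrow> (\<exists>a h. h > 0 \<and> Q = cube a h)"

definition dyadic_desc :: "(real^'n) set \<Rightarrow> (real^'n) set set" where
  "dyadic_desc Q = {R. \<exists>a h (k::nat) (j::real^'n). h > 0 \<and> Q = cube a h \<and>
      (\<forall>i. \<exists>m::nat. j $ i = real m \<and> m < 2 ^ k) \<and>
      R = cube (a + (h / 2 ^ k) *\<^sub>R j) (h / 2 ^ k)}"

definition locally_integrable :: "(real^'n \<Rightarrow> real) \<Rightarrow> bool" where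
  "locally_integrable f \<longleftrightarrow> f \<in> borel_measurable lebesgue \<and>
      (\<forall>K. compact K \<longrightarrow> set_integrable lebesgue K f)"

definition is_weight :: "(real^'n \<Rightarrow> real) \<Rightarrow> bool" where
  "is_weight w \<longleftrightarrow> locally_integrable w \<and> (\<forall>x. w x \<ge> 0)"

definition avg :: "(real^'n \<Rightarrow> real) \<Rightarrow> (real^'n) set \<Rightarrow> real" where
  "avg f Q = (LINT x:Q|lebesgue. f x) / measure lebesgue Q"

definition mean_abs :: "(real^'n \<Rightarrow> real) \<Rightarrow> (real^'n) set \<Rightarrow> ennreal" where
  "mean_abs g R = ennreal (1 / measure lebesgue R) * (\<integral>\<^sup>+ y\<in>R. ennreal \<bar>g y\<bar> \<partial>lebesgue)"

definition sharp_max :: "(real^'n \<Rightarrow> real) \<Rightarrow> real^'n \<Rightarrow> ennreal" where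
  "sharp_max f x = (SUP R\<in>{R. is_cube R \<and> x \<in> R}. mean_abs (\<lambda>y. f y - avg f R) R)"

definition loc_dyadic_max :: "(real^'n) set \<Rightarrow> (real^'n \<Rightarrow> real) \<Rightarrow> real^'n \<Rightarrow> ennreal" where
  "loc_dyadic_max Q h x = (SUP R\<in>{R\<in>dyadic_desc Q. x \<in> R}. mean_abs h R)"

definition hl_max :: "(real^'n \<Rightarrow> real) \<Rightarrow> real^'n \<Rightarrow> ennreal" where
  "hl_max g x = (SUP R\<in>{R. is_cube R \<and> x \<in> R}. mean_abs g R)"

definition ennpow :: "ennreal \<Rightarrow> real \<Rightarrow> ennreal" where
  "ennpow x p = (if x = top then top else ennreal (enn2real x powr p))"

definition wmeas :: "(real^'n \<Rightarrow> real) \<Rightarrow> (real^'n) set \<Rightarrow> ennreal" where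
  "wmeas w E = (\<integral>\<^sup>+ x\<in>E. ennreal (w x) \<partial>lebesgue)"

definition w_r :: "(real^'n \<Rightarrow> real) \<Rightarrow> real \<Rightarrow> (real^'n) set \<Rightarrow> ennreal" where
  "w_r w r Q = ennreal (measure lebesgue Q) *
     ennpow (ennreal (1 / measure lebesgue Q) * (\<integral>\<^sup>+ x\<in>Q. ennreal (w x powr r) \<partial>lebesgue)) (1 / r)"

text \<open>A_infinity constant (Fujii--Wilson).\<close>
definition Ainf_const :: "(real^'n \<Rightarrow> real) \<Rightarrow> ennreal" where
  "Ainf_const w = (SUP Q\<in>{Q. is_cube Q}.
      (\<integral>\<^sup>+ x\<in>Q. hl_max (\<lambda>y. w y * indicator Q y) x \<partial>lebesgue) / wmeas w Q)"

end

theory Submission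
  imports Defs
begin

text \<open>Calderon--Zygmund stopping times adapted to the oscillation of \<open>f\<close> inside \<open>Q\<close> (a cube stops
  below \<open>R\<close> when the average of \<open>\<bar>f - f\<^sub>R\<bar>\<close> over it exceeds four times the average over \<open>R\<close>) give
  nested levels with \<open>M\<^sub>Q(f - f\<^sub>Q)(x) \<le> 4 \<cdot> 2\<^sup>n N(x) M\<^sup>\<sharp>f(x)\<close>, where \<open>N(x)\<close> counts the levels
  containing \<open>x\<close>: each oscillation used along the chain of stopping cubes through \<open>x\<close> is at
  most \<open>M\<^sup>\<sharp>f(x)\<close>. Sparseness bounds the total weight of the levels from the \<open>j\<close>-th on by \<open>2A\<close>
  times that of the \<open>j\<close>-th, with \<open>A = [w]\<close> for an A-infinity weight and \<open>A = 1\<close> for \<open>w = 1\<close>.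
  Iterating this bounds the \<open>m\<close>-th weighted moment of \<open>N\<close> by \<open>m! (2A)\<^sup>m w(Q)\<close>. This gives the second
  estimate directly, without a reverse Hoelder inequality; the first one follows from the
  unweighted moment of order \<open>p r'\<close> and Young's inequality.\<close>

section \<open>Sparse families of nested sets\<close>

definition maximal_in :: "'a set set \<Rightarrow> 'a set set" where
  "maximal_in B = {S\<in>B. \<forall>T\<in>B. S \<subseteq> T \<longrightarrow> T = S}"

text \<open>Only countably many pairs occur, so the exceptional points form a null set. Closed
  dyadic cubes share faces, which is why disjointness is available only almost everywhere.\<close>

lemma AE_unique_of_null_inter:
  assumes "countable F" and null: "\<And>S T. S \<in> F \<Longrightarrow> T \<in> F \<Longrightarrow> S \<noteq> T \<Longrightarrow> S \<inter> T \<in> null_sets M"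
  shows "AE x in M. \<forall>S\<in>F. \<forall>T\<in>F. x \<in> S \<longrightarrow> x \<in> T \<longrightarrow> S = T"
proof -
  have "AE x in M. x \<in> S \<longrightarrow> x \<in> T \<longrightarrow> S = T" if "S \<in> F" "T \<in> F" for S T
  proof (cases "S = T")
    case False
    from AE_not_in[OF null[OF that this]] show ?thesis by eventually_elim auto
  qed simp
  then have "AE x in M. \<forall>T\<in>F. x \<in> S \<longrightarrow> x \<in> T \<longrightarrow> S = T" if "S \<in> F" for S
    using that by (subst AE_ball_countable[OF \<open>countable F\<close>]) (intro ballI)
  then show ?thesis
    by (subst AE_ball_countable[OF \<open>countable F\<close>]) (intro ballI)
qed

text \<open>Almost every point of the union lies in exactly one member, so the indicators of the
  members add up to that of the union. Writing the sum as an integral over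
  \<open>count_space F\<close> makes the exchange with the integral an instance of Tonelli. The
  density \<open>v\<close> lets one statement serve the base measure (\<open>v = 1\<close>) and the
  weight.\<close>

lemma emeasure_Union_null_inter:
  assumes F: "countable F" "F \<subseteq> sets M"
    and null: "\<And>S T. S \<in> F \<Longrightarrow> T \<in> F \<Longrightarrow> S \<noteq> T \<Longrightarrow> S \<inter> T \<in> null_sets M"
    and v: "v \<in> borel_measurable M"
  shows "emeasure (density M v) (\<Union>F) = (\<integral>\<^sup>+S. emeasure (density M v) S \<partial>count_space F)"
proof -
  have unique: "AE x in M. \<forall>S\<in>F. \<forall>T\<in>F. x \<in> S \<longrightarrow> x \<in> T \<longrightarrow> S = T"
    using F(1) null by (rule AE_unique_of_null_inter)
  have "(\<integral>\<^sup>+S. emeasure (density M v) S \<partial>count_space F)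
      = (\<integral>\<^sup>+S. (\<integral>\<^sup>+x. v x * indicator S x \<partial>M) \<partial>count_space F)"
    using F by (intro nn_integral_cong emeasure_density v) auto
  also have "\<dots> = (\<integral>\<^sup>+x. (\<integral>\<^sup>+S. v x * indicator S x \<partial>count_space F) \<partial>M)"
    using F v
    by (intro nn_integral_count_space_nn_integral[symmetric]
        borel_measurable_times_ennreal borel_measurable_indicator) auto
  also have "\<dots> = (\<integral>\<^sup>+x. v x * indicator (\<Union>F) x \<partial>M)"
  proof (rule nn_integral_cong_AE, use unique in eventually_elim)
    case (elim x)
    show ?case
    proof (cases "x \<in> \<Union>F")
      case True
      then obtain R where R: "R \<in> F" "x \<in> R" by auto
      have "(\<integral>\<^sup>+S. v x * indicator S x \<partial>count_space F)
          = (\<integral>\<^sup>+S. v x * indicator {R} S \<partial>count_space F)"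
        using elim R by (intro nn_integral_cong) (auto split: split_indicator)
      also have "\<dots> = v x"
        using R by (simp add: nn_integral_cmult)
      finally show ?thesis using True by simp
    next
      case False
      then have "(\<integral>\<^sup>+S. v x * indicator S x \<partial>count_space F) = (\<integral>\<^sup>+S. 0 \<partial>count_space F)"
        by (intro nn_integral_cong) (auto split: split_indicator)
      with False show ?thesis by simp
    qed
  qed
  also have "\<dots> = emeasure (density M v) (\<Union>F)"
    using F by (intro emeasure_density[symmetric] v sets.countable_Union)
  finally show ?thesis ..
qed

lemma ennreal_divide_mult_cancel: "x \<noteq> 0 \<Longrightarrow> x \<noteq> \<infinity> \<Longrightarrow> a / x * x = (a::ennreal)"
  by (subst ennreal_divide_times, subst ennreal_times_divide, subst mult_divide_eq_ennreal) auto

text \<open>Abstracts the dyadic descendants of a cube. Finiteness of the ancestors of a set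
  guarantees maximal members of any subfamily.\<close>

locale nested_family =
  fixes M :: "'a measure" and D :: "'a set set"
  assumes countable_D: "countable D"
    and sets_D: "R \<in> D \<Longrightarrow> R \<in> sets M"
    and emeasure_pos: "R \<in> D \<Longrightarrow> emeasure M R \<noteq> 0"
    and emeasure_finite: "R \<in> D \<Longrightarrow> emeasure M R \<noteq> \<infinity>"
    and nested: "R \<in> D \<Longrightarrow> S \<in> D \<Longrightarrow> R \<subseteq> S \<or> S \<subseteq> R \<or> R \<inter> S \<in> null_sets M"
    and finite_ancestors: "R \<in> D \<Longrightarrow> finite {S\<in>D. R \<subseteq> S}"
begin

lemma maximal_in_exists:
  assumes "B \<subseteq> D" "S \<in> B"
  shows "\<exists>T\<in>maximal_in B. S \<subseteq> T"
proof -
  have "finite {T\<in>B. S \<subseteq> T}"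
    by (rule finite_subset[OF _ finite_ancestors[of S]]) (use assms in auto)
  from finite_has_maximal2[OF this, of S] assms(2)
  obtain T where T: "T \<in> B" "S \<subseteq> T" "\<And>U. U \<in> B \<Longrightarrow> S \<subseteq> U \<Longrightarrow> T \<subseteq> U \<Longrightarrow> T = U"
    by auto
  have "T \<in> maximal_in B"
    unfolding maximal_in_def
    using T(1) T(2) T(3) by (auto dest: subset_trans)
  then show ?thesis
    using T(2) by blast
qed

lemma maximal_in_null_inter:
  assumes "B \<subseteq> D" "S \<in> maximal_in B" "T \<in> maximal_in B" "S \<noteq> T"
  shows "S \<inter> T \<in> null_sets M"
  using assms nested[of S T] unfolding maximal_in_def by blast

text \<open>This is the weak type (1,1) argument. The maximal sets are essentially disjoint, and on
  each the \<open>N\<close>-average exceeds four times the average \<open>?a\<close> over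
  \<open>R\<close>; summing gives \<open>4 * ?a\<close> times the measure of their union at most
  \<open>emeasure N R\<close>, which is \<open>?a * emeasure M R\<close>. A bound by a quarter
  results, of which a half is recorded.\<close>

lemma emeasure_Union_maximal_le:
  fixes v :: "'a \<Rightarrow> ennreal"
  defines "N \<equiv> density M v"
  defines "B \<equiv> \<lambda>R. {S\<in>D. S \<subset> R \<and> 4 * (emeasure N R / emeasure M R) < emeasure N S / emeasure M S}"
  assumes v: "v \<in> borel_measurable M" and R: "R \<in> D"
  shows "2 * emeasure M (\<Union>(maximal_in (B R))) \<le> emeasure M R"
proof (cases "B R = {}")
  case True
  then show ?thesis by (simp add: maximal_in_def)
next
  case False
  let ?F = "maximal_in (B R)" and ?a = "emeasure N R / emeasure M R"
  have BD: "B R \<subseteq> D" unfolding B_def by auto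
  have F: "?F \<subseteq> D" "countable ?F" "?F \<subseteq> sets M" "\<Union>?F \<subseteq> R"
    using BD sets_D countable_subset[OF _ countable_D, of ?F] unfolding maximal_in_def B_def by auto
  have cancel: "emeasure N S / emeasure M S * emeasure M S = emeasure N S" if "S \<in> D" for S
    using that by (simp add: ennreal_divide_mult_cancel emeasure_pos emeasure_finite[unfolded infinity_ennreal_def])
  have mono: "emeasure N S \<le> emeasure N R" if "S \<subseteq> R" for S
    using that R sets_D by (intro emeasure_mono) (auto simp: N_def)
  have "emeasure M (\<Union>?F) = emeasure (density M (\<lambda>_. 1)) (\<Union>?F)"
    by (simp add: density_1)
  also have "\<dots> = (\<integral>\<^sup>+S. emeasure M S \<partial>count_space ?F)"
    using emeasure_Union_null_inter[OF F(2,3), of "\<lambda>_. 1"] maximal_in_null_inter[OF BD]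
    by (simp add: density_1)
  finally have "4 * ?a * emeasure M (\<Union>?F) = (\<integral>\<^sup>+S. 4 * ?a * emeasure M S \<partial>count_space ?F)"
    by (simp add: nn_integral_cmult)
  also have "\<dots> \<le> (\<integral>\<^sup>+S. emeasure N S \<partial>count_space ?F)"
  proof (intro nn_integral_mono)
    fix S assume "S \<in> space (count_space ?F)"
    then have S: "S \<in> D" "4 * ?a < emeasure N S / emeasure M S"
      by (auto simp: maximal_in_def B_def)
    then have "4 * ?a * emeasure M S \<le> emeasure N S / emeasure M S * emeasure M S"
      by (intro mult_right_mono) auto
    then show "4 * ?a * emeasure M S \<le> emeasure N S" using cancel[OF S(1)] by simp
  qed
  also have "\<dots> = emeasure N (\<Union>?F)"
    unfolding N_def using emeasure_Union_null_inter[OF F(2,3) _ v] maximal_in_null_inter[OF BD] by simp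
  also have "\<dots> \<le> ?a * emeasure M R"
    using mono[OF F(4)] cancel[OF R] by simp
  finally have *: "?a * (4 * emeasure M (\<Union>?F)) \<le> ?a * emeasure M R"
    by (simp add: mult_ac)
  \<comment> \<open>Cancelling \<open>?a\<close> requires it to be nonzero and finite. One stopping
    set \<open>S\<close> gives both: a zero average over \<open>R\<close> would force a zero average
    over \<open>S\<close>, and no average exceeds \<open>top\<close>.\<close>
  from False obtain S where S: "S \<in> D" "S \<subset> R" "4 * ?a < emeasure N S / emeasure M S"
    unfolding B_def by auto
  have "?a \<noteq> 0"
  proof
    assume "?a = 0"
    then have "emeasure N R = 0" using cancel[OF R] emeasure_finite[OF R] by auto
    then have "emeasure N S = 0" using mono[of S] S by auto
    with S show False by simp
  qed
  moreover have "?a < \<infinity>"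
    using S(3) by (cases "?a = top") (auto simp: ennreal_mult_eq_top_iff top.not_eq_extremum)
  ultimately have "4 * emeasure M (\<Union>?F) \<le> emeasure M R"
    using * by (simp add: ennreal_mult_le_mult_iff)
  moreover have "2 * emeasure M (\<Union>?F) \<le> 4 * emeasure M (\<Union>?F)"
    by (intro mult_right_mono) auto
  ultimately show ?thesis by simp
qed

text \<open>The dyadic maximal function of the measure \<open>N\<close>, localized to
  \<open>R\<close>; for \<open>N\<close> with density \<open>w\<close> it is the dyadic counterpart
  of the maximal function in the A-infinity constant.\<close>

definition weighted_max :: "'a measure \<Rightarrow> 'a set \<Rightarrow> 'a \<Rightarrow> ennreal" where
  "weighted_max N R x = (SUP S\<in>{S\<in>D. S \<subseteq> R}. emeasure N S / emeasure M S * indicator S x)"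

lemma weighted_max_measurable [measurable]: "weighted_max N R \<in> borel_measurable M"
proof -
  have "countable {S\<in>D. S \<subseteq> R}"
    using countable_D by (rule countable_subset[rotated]) auto
  then show ?thesis
    unfolding weighted_max_def
    by (intro borel_measurable_SUP borel_measurable_times_ennreal borel_measurable_const
        borel_measurable_indicator) (auto simp: sets_D)
qed

end

section \<open>Generations of stopping sets and their packing estimate\<close>

locale stopping_family = nested_family +
  fixes Q :: "'a set" and children :: "'a set \<Rightarrow> 'a set set"
  assumes Q_in_D: "Q \<in> D"
    and children_D: "R \<in> D \<Longrightarrow> children R \<subseteq> D"
    and children_subset: "R \<in> D \<Longrightarrow> S \<in> children R \<Longrightarrow> S \<subset> R"
    and children_null_inter:
      "R \<in> D \<Longrightarrow> S \<in> children R \<Longrightarrow> T \<in> children R \<Longrightarrow> S \<noteq> T \<Longrightarrow> S \<inter> T \<in> null_sets M"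
    and children_half: "R \<in> D \<Longrightarrow> 2 * emeasure M (\<Union>(children R)) \<le> emeasure M R"
begin

primrec layer :: "nat \<Rightarrow> 'a set set" where
  "layer 0 = {Q}"
| "layer (Suc k) = (\<Union>R\<in>layer k. children R)"

definition level :: "nat \<Rightarrow> 'a set" where
  "level k = \<Union>(layer k)"

lemma level_0 [simp]: "level 0 = Q"
  by (simp add: level_def)

lemma layer_subset_D: "layer k \<subseteq> D"
  by (induction k) (use Q_in_D children_D in auto)

lemma countable_layer: "countable (layer k)"
  using countable_subset[OF layer_subset_D countable_D] .

lemma level_sets [measurable]: "level k \<in> sets M"
  unfolding level_def using countable_layer layer_subset_D sets_D
  by (intro sets.countable_Union) auto

lemma layer_ancestor:
  assumes "S \<in> layer k" "j \<le> k"
  shows "\<exists>R\<in>layer j. S \<subseteq> R"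
  using assms(2,1)
proof (induction k arbitrary: S rule: dec_induct)
  case base
  then show ?case by blast
next
  case (step k)
  then obtain T where "T \<in> layer k" "S \<in> children T" by auto
  with step.IH[of T] children_subset[of T S] layer_subset_D show ?case
    by blast
qed

lemma level_antimono: "j \<le> k \<Longrightarrow> level k \<subseteq> level j"
  unfolding level_def using layer_ancestor[of _ k j] by blast

text \<open>Sets with a common parent are covered by \<open>children_null_inter\<close>; sets with
  different parents meet inside the intersection of the parents, which is null by induction.\<close>

lemma layer_null_inter:
  "S \<in> layer k \<Longrightarrow> T \<in> layer k \<Longrightarrow> S \<noteq> T \<Longrightarrow> S \<inter> T \<in> null_sets M"
proof (induction k arbitrary: S T)
  case 0
  then show ?case by simp
next
  case (Suc k)
  from Suc.prems obtain S' T' where *: "S' \<in> layer k" "S \<in> children S'" "T' \<in> layer k" "T \<in> children T'"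
    by auto
  have D: "S' \<in> D" "T' \<in> D" "S \<in> D" "T \<in> D"
    using * Suc.prems layer_subset_D by blast+
  show ?case
  proof (cases "S' = T'")
    case True
    then show ?thesis using children_null_inter[OF D(1), of S T] * Suc.prems by simp
  next
    case False
    then have "S' \<inter> T' \<in> null_sets M" using Suc.IH * by blast
    moreover have "S \<inter> T \<subseteq> S' \<inter> T'" using * D children_subset by blast
    ultimately show ?thesis
      using sets_D D by (meson null_sets_subset sets.Int)
  qed
qed

lemma AE_layer_unique:
  "AE x in M. \<forall>k. \<forall>S\<in>layer k. \<forall>T\<in>layer k. x \<in> S \<longrightarrow> x \<in> T \<longrightarrow> S = T"
  by (subst AE_all_countable) (intro allI AE_unique_of_null_inter countable_layer layer_null_inter)

text \<open>The children of \<open>S\<close> fill at most half of it. The next level may also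
  contain children of other sets of the layer, but almost no point of \<open>S\<close> lies in
  those.\<close>

lemma emeasure_minus_level:
  assumes "S \<in> layer k"
  shows "emeasure M S \<le> 2 * emeasure M (S - level (Suc k))"
proof -
  have SD: "S \<in> D" using assms layer_subset_D by blast
  have ch: "\<Union>(children S) \<in> sets M"
    using children_D[OF SD] sets_D countable_subset[OF _ countable_D]
    by (intro sets.countable_Union) auto
  have "AE x in M. x \<in> S \<inter> level (Suc k) \<longrightarrow> x \<in> \<Union>(children S)"
    using AE_layer_unique
  proof eventually_elim
    case (elim x)
    show ?case
    proof
      assume "x \<in> S \<inter> level (Suc k)"
      then obtain R T where RT: "R \<in> layer k" "T \<in> children R" "x \<in> T" "x \<in> S"
        by (auto simp: level_def)
      then have "x \<in> R" using children_subset layer_subset_D by blast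
      then have "R = S" using elim RT assms by blast
      then show "x \<in> \<Union>(children S)" using RT by blast
    qed
  qed
  then have "emeasure M (S \<inter> level (Suc k)) \<le> emeasure M (\<Union>(children S))"
    using ch by (intro emeasure_mono_AE) auto
  then have "2 * emeasure M (S \<inter> level (Suc k)) \<le> emeasure M S"
    using children_half[OF SD] by (meson mult_left_mono order_trans zero_le)
  moreover have "emeasure M S = emeasure M (S \<inter> level (Suc k)) + emeasure M (S - level (Suc k))"
    using sets_D[OF SD] by (subst plus_emeasure) (auto intro: arg_cong[where f="emeasure M"])
  \<comment> \<open>With \<open>a\<close> and \<open>b\<close> the measures of the two parts of
    \<open>S\<close>, sparseness says \<open>2 * a \<le> a + b\<close>. Finiteness of
    \<open>a\<close> allows cancellation to \<open>a \<le> b\<close>, hence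
    \<open>a + b \<le> 2 * b\<close>.\<close>
  moreover have "emeasure M (S \<inter> level (Suc k)) \<noteq> \<infinity>"
    using emeasure_finite[OF SD] emeasure_mono[of "S \<inter> level (Suc k)" S M] sets_D[OF SD]
    by (auto simp: top_unique)
  ultimately show ?thesis
    unfolding mult_2 by (metis add_right_mono ennreal_add_left_cancel_le)
qed

lemma emeasure_level:
  assumes v: "v \<in> borel_measurable M"
  shows "emeasure (density M v) (level k) = (\<integral>\<^sup>+S. emeasure (density M v) S \<partial>count_space (layer k))"
  unfolding level_def using countable_layer layer_subset_D sets_D layer_null_inter
  by (intro emeasure_Union_null_inter v) auto

text \<open>The differences \<open>level k - level (Suc k)\<close> are pairwise disjoint and
  \<open>x\<close> lies in at most one set of each layer, so at most one term of the double sum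
  survives. It is an average over a set containing \<open>x\<close> and is bounded by the maximal
  function of the ancestor in layer \<open>j\<close>.\<close>

lemma layer_sum_le_weighted_max:
  assumes uniq: "\<forall>k. \<forall>S\<in>layer k. \<forall>T\<in>layer k. x \<in> S \<longrightarrow> x \<in> T \<longrightarrow> S = T"
  shows "(\<Sum>k=j..<L. \<integral>\<^sup>+S. emeasure N S / emeasure M S * indicator (S - level (Suc k)) x \<partial>count_space (layer k))
    \<le> (\<integral>\<^sup>+R. weighted_max N R x * indicator R x \<partial>count_space (layer j))"
    (is "(\<Sum>k=j..<L. ?g k) \<le> ?G")
proof (cases "\<exists>k\<in>{j..<L}. x \<in> level k - level (Suc k)")
  case False
  have "?g k = 0" if "k \<in> {j..<L}" for k
  proof -
    have "?g k = (\<integral>\<^sup>+S. 0 \<partial>count_space (layer k))"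
      using False that by (intro nn_integral_cong) (auto split: split_indicator simp: level_def)
    then show ?thesis by simp
  qed
  then show ?thesis by simp
next
  case True
  then obtain k where k: "j \<le> k" "k < L" "x \<in> level k" "x \<notin> level (Suc k)" by auto
  then obtain S where S: "S \<in> layer k" "x \<in> S" by (auto simp: level_def)
  obtain R where R: "R \<in> layer j" "S \<subseteq> R" using layer_ancestor S k by blast
  have other: "?g i = 0" if "i \<noteq> k" for i
  proof -
    have "\<not> (x \<in> level i \<and> x \<notin> level (Suc i))"
      using k that level_antimono[of "Suc i" k] level_antimono[of "Suc k" i]
      by (metis Suc_leI linorder_neqE_nat subsetD)
    then have "?g i = (\<integral>\<^sup>+S. 0 \<partial>count_space (layer i))"
      by (intro nn_integral_cong) (auto split: split_indicator simp: level_def)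
    then show ?thesis by simp
  qed
  have "(\<Sum>k=j..<L. ?g k) = ?g k"
    using k other by (subst sum.remove[of _ k]) (auto intro!: sum.neutral)
  also have "\<dots> = (\<integral>\<^sup>+T. (emeasure N S / emeasure M S) * indicator {S} T \<partial>count_space (layer k))"
    using uniq S k by (intro nn_integral_cong) (auto split: split_indicator)
  also have "\<dots> = emeasure N S / emeasure M S * indicator S x"
    using S by (simp add: nn_integral_cmult)
  also have "\<dots> \<le> weighted_max N R x"
    unfolding weighted_max_def using S R layer_subset_D by (intro SUP_upper) auto
  also have "\<dots> = (\<integral>\<^sup>+T. weighted_max N R x * indicator {R} T \<partial>count_space (layer j))"
    using R by (simp add: nn_integral_cmult)
  also have "\<dots> \<le> ?G"
    using R S by (intro nn_integral_mono) (auto split: split_indicator)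
  finally show ?thesis .
qed

text \<open>A Carleson packing estimate. Writing \<open>emeasure ?N S\<close> as average times
  \<open>emeasure M S\<close> and replacing the latter by twice the measure of the unstopped part of
  \<open>S\<close> turns the sum into the integral of a function lying below the maximal functions
  of layer \<open>j\<close>, to which hypothesis \<open>A\<close> applies.\<close>

lemma sum_level_le:
  assumes v: "v \<in> borel_measurable M"
    and A: "\<And>R. R \<in> D \<Longrightarrow> (\<integral>\<^sup>+x\<in>R. weighted_max (density M v) R x \<partial>M) \<le> A * emeasure (density M v) R"
  shows "(\<Sum>k=j..<L. emeasure (density M v) (level k)) \<le> 2 * A * emeasure (density M v) (level j)"
proof -
  let ?N = "density M v"
  let ?g = "\<lambda>k S x. emeasure ?N S / emeasure M S * indicator (S - level (Suc k)) x"
  have S_le: "emeasure ?N S \<le> 2 * (\<integral>\<^sup>+x. ?g k S x \<partial>M)" if "S \<in> layer k" for S k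
  proof -
    have SD: "S \<in> D" using that layer_subset_D by blast
    have "emeasure ?N S = emeasure ?N S / emeasure M S * emeasure M S"
      using emeasure_pos[OF SD] emeasure_finite[OF SD]
      by (simp add: ennreal_divide_mult_cancel)
    also have "\<dots> \<le> emeasure ?N S / emeasure M S * (2 * emeasure M (S - level (Suc k)))"
      using emeasure_minus_level[OF that] by (intro mult_left_mono) auto
    also have "\<dots> = 2 * (\<integral>\<^sup>+x. ?g k S x \<partial>M)"
      using sets_D[OF SD] by (subst nn_integral_cmult_indicator) (auto simp: mult_ac)
    finally show ?thesis .
  qed
  have g_meas: "?g k S \<in> borel_measurable M" if "S \<in> layer k" for k S
    using that layer_subset_D sets_D
    by (intro borel_measurable_times_ennreal borel_measurable_indicator sets.Diff) auto
  \<comment> \<open>Measurability of the sum over a layer, needed to move the integral outside the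
    finite sum over \<open>k\<close>, rests on the counting measure of a countable layer being
    sigma-finite.\<close>
  have g_int_meas: "(\<lambda>x. \<integral>\<^sup>+S. ?g k S x \<partial>count_space (layer k)) \<in> borel_measurable M" for k
  proof -
    interpret sigma_finite_measure "count_space (layer k)"
      by (rule sigma_finite_measure_count_space_countable[OF countable_layer])
    show ?thesis
      using g_meas
      by (intro borel_measurable_nn_integral)
        (auto simp: split_beta' intro!: measurable_compose_countable'[OF _ measurable_snd countable_layer]
          measurable_compose[OF measurable_fst])
  qed
  have "(\<Sum>k=j..<L. emeasure ?N (level k))
      = (\<Sum>k=j..<L. \<integral>\<^sup>+S. emeasure ?N S \<partial>count_space (layer k))"
    by (simp add: emeasure_level v)
  also have "\<dots> \<le> (\<Sum>k=j..<L. \<integral>\<^sup>+S. 2 * (\<integral>\<^sup>+x. ?g k S x \<partial>M) \<partial>count_space (layer k))"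
    using S_le by (intro sum_mono nn_integral_mono) auto
  also have "\<dots> = 2 * (\<Sum>k=j..<L. \<integral>\<^sup>+S. (\<integral>\<^sup>+x. ?g k S x \<partial>M) \<partial>count_space (layer k))"
    by (simp add: nn_integral_cmult sum_distrib_left)
  also have "\<dots> = 2 * (\<Sum>k=j..<L. \<integral>\<^sup>+x. (\<integral>\<^sup>+S. ?g k S x \<partial>count_space (layer k)) \<partial>M)"
    by (subst nn_integral_count_space_nn_integral) (use g_meas in \<open>auto simp: countable_layer\<close>)
  also have "\<dots> = 2 * (\<integral>\<^sup>+x. (\<Sum>k=j..<L. \<integral>\<^sup>+S. ?g k S x \<partial>count_space (layer k)) \<partial>M)"
    by (subst nn_integral_sum) (use g_int_meas in auto)
  also have "\<dots> \<le> 2 * (\<integral>\<^sup>+x. (\<integral>\<^sup>+R. weighted_max ?N R x * indicator R x \<partial>count_space (layer j)) \<partial>M)"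
  proof (intro mult_left_mono nn_integral_mono_AE)
    show "AE x in M. (\<Sum>k=j..<L. \<integral>\<^sup>+S. ?g k S x \<partial>count_space (layer k))
        \<le> (\<integral>\<^sup>+R. weighted_max ?N R x * indicator R x \<partial>count_space (layer j))"
      using AE_layer_unique by eventually_elim (rule layer_sum_le_weighted_max)
  qed simp
  also have "\<dots> = 2 * (\<integral>\<^sup>+R. (\<integral>\<^sup>+x. weighted_max ?N R x * indicator R x \<partial>M) \<partial>count_space (layer j))"
    by (subst nn_integral_count_space_nn_integral)
      (use layer_subset_D sets_D in \<open>auto simp: countable_layer
        intro!: borel_measurable_times_ennreal borel_measurable_indicator\<close>)
  also have "\<dots> \<le> 2 * (\<integral>\<^sup>+R. A * emeasure ?N R \<partial>count_space (layer j))"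
    using A layer_subset_D by (intro mult_left_mono nn_integral_mono) auto
  also have "\<dots> = 2 * A * emeasure ?N (level j)"
    by (simp add: nn_integral_cmult emeasure_level v mult.assoc)
  finally show ?thesis .
qed

text \<open>The counting function of the levels, truncated at \<open>L\<close> to stay real-valued.
  The lower index \<open>j\<close> is what the induction on moments varies; the truncation is
  removed at the end by monotone convergence.\<close>

definition depth :: "nat \<Rightarrow> nat \<Rightarrow> 'a \<Rightarrow> real" where
  "depth j L x = (\<Sum>k=j..<L. indicator (level k) x)"

lemma depth_nonneg: "0 \<le> depth j L x"
  unfolding depth_def by (intro sum_nonneg) auto

lemma depth_measurable [measurable]: "depth j L \<in> borel_measurable M"
  unfolding depth_def by measurable

lemma depth_outside: "x \<notin> level j \<Longrightarrow> depth j L x = 0"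
  unfolding depth_def
proof (intro sum.neutral ballI)
  fix k assume "x \<notin> level j" "k \<in> {j..<L}"
  with level_antimono[of j k] show "indicat_real (level k) x = 0" by (auto simp: indicator_def)
qed

text \<open>A discrete form of integrating \<open>(m + 1) * s ^ m\<close>. Passing from
  \<open>Suc j\<close> to \<open>j\<close> at a point of level \<open>j\<close> raises the depth
  from \<open>t\<close> to \<open>t + 1\<close>, and the power grows by at most
  \<open>Suc m * (t + 1) ^ m\<close>, which is the new term \<open>i = j\<close>.\<close>

lemma depth_power_le:
  "depth j L x ^ Suc m \<le> Suc m * (\<Sum>i=j..<L. depth i L x ^ m * indicator (level i) x)"
proof (induction "L - j" arbitrary: j)
  case 0
  then show ?case by (simp add: depth_def)
next
  case (Suc d)
  then have jL: "j < L" by simp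
  have IH: "depth (Suc j) L x ^ Suc m
      \<le> Suc m * (\<Sum>i=Suc j..<L. depth i L x ^ m * indicator (level i) x)"
    using Suc by (intro Suc.hyps) simp
  show ?case
  proof (cases "x \<in> level j")
    case False
    then show ?thesis
      by (simp add: depth_outside sum_nonneg depth_nonneg)
  next
    case True
    define t where "t = depth (Suc j) L x"
    have t: "depth j L x = t + 1" "0 \<le> t"
      using True jL unfolding t_def depth_def
      by (simp_all add: sum.atLeast_Suc_lessThan sum_nonneg)
    have "(t + 1) ^ Suc m - t ^ Suc m = (\<Sum>p<Suc m. (t + 1) ^ p * t ^ (m - p))"
      using power_diff_sumr2[of "t + 1" "Suc m" t] by (simp add: mult.commute)
    also have "\<dots> \<le> (\<Sum>p<Suc m. (t + 1) ^ m)"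
    proof (intro sum_mono)
      fix p assume "p \<in> {..<Suc m}"
      then have p: "(t + 1) ^ m = (t + 1) ^ p * (t + 1) ^ (m - p)"
        by (simp flip: power_add)
      show "(t + 1) ^ p * t ^ (m - p) \<le> (t + 1) ^ m"
        unfolding p using t(2) by (intro mult_left_mono power_mono) auto
    qed
    finally have "(t + 1) ^ Suc m \<le> t ^ Suc m + Suc m * (t + 1) ^ m"
      by simp
    also have "\<dots> \<le> Suc m * (\<Sum>i=Suc j..<L. depth i L x ^ m * indicator (level i) x)
        + Suc m * (t + 1) ^ m"
      using IH by (simp add: t_def)
    also have "\<dots> = Suc m * (\<Sum>i=j..<L. depth i L x ^ m * indicator (level i) x)"
      unfolding sum.atLeast_Suc_lessThan[OF jL] t(1)[symmetric] distrib_left using True by simp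
    finally show ?thesis by (simp add: t)
  qed
qed

text \<open>Induction on the order: \<open>depth_power_le\<close> reduces the moment on level \<open>j\<close> to lower
  moments on the levels \<open>i \<ge> j\<close>, whose weights sum to at most \<open>B\<close> times that of level \<open>j\<close>.\<close>

lemma depth_moment:
  assumes v [measurable]: "v \<in> borel_measurable M"
    and B: "\<And>j. (\<Sum>k=j..<L. emeasure (density M v) (level k)) \<le> ennreal B * emeasure (density M v) (level j)"
    and "0 \<le> B"
  shows "(\<integral>\<^sup>+x\<in>level j. ennreal (depth j L x ^ m) \<partial>density M v)
    \<le> ennreal (fact m * B ^ m) * emeasure (density M v) (level j)"
proof (induction m arbitrary: j)
  case 0
  then show ?case by simp
next
  case (Suc m)
  let ?N = "density M v"
  have "(\<integral>\<^sup>+x\<in>level j. ennreal (depth j L x ^ Suc m) \<partial>?N)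
      \<le> (\<integral>\<^sup>+x. (\<Sum>i=j..<L. ennreal (Suc m) * (ennreal (depth i L x ^ m) * indicator (level i) x)) \<partial>?N)"
  proof (intro nn_integral_mono)
    fix x
    have "ennreal (depth j L x ^ Suc m) * indicator (level j) x \<le> ennreal (depth j L x ^ Suc m)"
      by (simp split: split_indicator)
    also have "\<dots> \<le> ennreal (\<Sum>i=j..<L. Suc m * (depth i L x ^ m * indicator (level i) x))"
      using depth_power_le[of j L x m] by (intro ennreal_leI) (simp only: sum_distrib_left)
    also have "\<dots> = (\<Sum>i=j..<L. ennreal (Suc m * (depth i L x ^ m * indicator (level i) x)))"
      by (rule sum_ennreal[symmetric]) (simp add: depth_nonneg)
    also have "\<dots> = (\<Sum>i=j..<L. ennreal (Suc m) * (ennreal (depth i L x ^ m) * indicator (level i) x))"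
      by (intro sum.cong refl) (simp add: ennreal_mult depth_nonneg ennreal_indicator del: of_nat_Suc)
    finally show "ennreal (depth j L x ^ Suc m) * indicator (level j) x \<le> \<dots>" .
  qed
  also have "\<dots> = (\<Sum>i=j..<L. ennreal (Suc m) * (\<integral>\<^sup>+x. ennreal (depth i L x ^ m) * indicator (level i) x \<partial>?N))"
    by (simp add: nn_integral_sum nn_integral_cmult del: of_nat_Suc)
  also have "\<dots> \<le> (\<Sum>i=j..<L. ennreal (Suc m) * (ennreal (fact m * B ^ m) * emeasure ?N (level i)))"
    using Suc.IH by (intro sum_mono mult_left_mono) auto
  also have "\<dots> = ennreal (Suc m) * ennreal (fact m * B ^ m) * (\<Sum>i=j..<L. emeasure ?N (level i))"
    by (simp add: sum_distrib_left mult_ac del: of_nat_Suc)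
  also have "\<dots> \<le> ennreal (Suc m) * ennreal (fact m * B ^ m) * (ennreal B * emeasure ?N (level j))"
    by (intro mult_left_mono B) auto
  also have "\<dots> = ennreal (Suc m) * ennreal (fact m * B ^ m) * ennreal B * emeasure ?N (level j)"
    by (simp only: mult.assoc)
  also have "ennreal (Suc m) * ennreal (fact m * B ^ m) * ennreal B = ennreal (Suc m * (fact m * B ^ m) * B)"
    using \<open>0 \<le> B\<close> by (simp add: ennreal_mult)
  also have "Suc m * (fact m * B ^ m) * B = fact (Suc m) * B ^ Suc m"
    by (simp add: algebra_simps)
  finally show ?case .
qed

text \<open>Real exponents are reached from the integer \<open>m\<close>, the ceiling of
  \<open>p\<close>. With \<open>K = m * B\<close> the bound \<open>fact m \<le> m ^ m\<close> makes
  the normalized \<open>m\<close>-th moment at most the mass of \<open>Q\<close>, so the integral is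
  at most \<open>2 * K powr p\<close> times that mass. Then \<open>2 \<le> 2 powr p\<close> and
  \<open>m \<le> 2 * p\<close> produce \<open>4 * p * B\<close>.\<close>

lemma depth_powr_moment:
  assumes v: "v \<in> borel_measurable M"
    and B: "\<And>j. (\<Sum>k=j..<L. emeasure (density M v) (level k)) \<le> ennreal B * emeasure (density M v) (level j)"
    and "0 < B" "1 \<le> p"
  shows "(\<integral>\<^sup>+x. ennreal (depth 0 L x powr p) \<partial>density M v)
    \<le> ennreal ((4 * p * B) powr p) * emeasure (density M v) Q"
proof -
  let ?N = "density M v"
  define m where "m = nat \<lceil>p\<rceil>"
  have m: "p \<le> real m" "real m \<le> 2 * p" "0 < m"
    using \<open>1 \<le> p\<close> unfolding m_def by linarith+
  define K where "K = real m * B"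
  have K: "0 < K" using m \<open>0 < B\<close> by (simp add: K_def)
  \<comment> \<open>Below \<open>K\<close> the constant term suffices; above it \<open>t / K\<close>
    exceeds 1, so raising the exponent from \<open>p\<close> to \<open>m\<close> increases the
    power.\<close>
  have pw: "t powr p \<le> K powr p * (1 + t ^ m / K ^ m)" if "0 \<le> t" for t
  proof (cases "t \<le> K")
    case True
    then have "t powr p \<le> K powr p" using that \<open>1 \<le> p\<close> by (intro powr_mono2) auto
    also have "\<dots> \<le> K powr p * (1 + t ^ m / K ^ m)"
      using that K by (intro mult_le_cancel_left1[THEN iffD2]) auto
    finally show ?thesis .
  next
    case False
    then have "(t / K) powr p \<le> (t / K) powr real m"
      using K m by (intro powr_mono) auto
    also have "\<dots> = t ^ m / K ^ m"
      using K False by (simp add: powr_realpow power_divide)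
    finally have "K powr p * (t / K) powr p \<le> K powr p * (1 + t ^ m / K ^ m)"
      by (intro mult_left_mono) auto
    moreover have "K powr p * (t / K) powr p = t powr p"
      using K that by (simp add: powr_divide)
    ultimately show ?thesis by simp
  qed
  have "(\<integral>\<^sup>+x. ennreal (depth 0 L x powr p) \<partial>?N)
      \<le> (\<integral>\<^sup>+x. ennreal (K powr p) * (indicator Q x + ennreal (1 / K ^ m) * (ennreal (depth 0 L x ^ m) * indicator Q x)) \<partial>?N)"
  proof (intro nn_integral_mono)
    fix x
    show "ennreal (depth 0 L x powr p) \<le> ennreal (K powr p) * (indicator Q x + ennreal (1 / K ^ m) * (ennreal (depth 0 L x ^ m) * indicator Q x))"
    proof (cases "x \<in> Q")
      case True
      have "ennreal (depth 0 L x powr p) \<le> ennreal (K powr p * (1 + 1 / K ^ m * depth 0 L x ^ m))"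
        using pw[OF depth_nonneg, of 0 L x] by (intro ennreal_leI) simp
      also have "\<dots> = ennreal (K powr p) * (1 + ennreal (1 / K ^ m) * ennreal (depth 0 L x ^ m))"
        using K depth_nonneg[of 0 L x] by (simp add: ennreal_mult ennreal_plus del: times_divide_eq_left)
      finally show ?thesis using True by simp
    next
      case False
      then show ?thesis using depth_outside[of x 0 L] by simp
    qed
  qed
  also have "\<dots> = ennreal (K powr p) * (emeasure ?N Q + ennreal (1 / K ^ m) * (\<integral>\<^sup>+x\<in>Q. ennreal (depth 0 L x ^ m) \<partial>?N))"
    using sets_D[OF Q_in_D] by (simp add: nn_integral_cmult nn_integral_add)
  also have "\<dots> \<le> ennreal (K powr p) * (emeasure ?N Q + ennreal (1 / K ^ m) * (ennreal (fact m * B ^ m) * emeasure ?N Q))"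
    using depth_moment[OF v B, of 0 m] \<open>0 < B\<close> by (intro mult_left_mono add_left_mono) auto
  also have "\<dots> = ennreal (K powr p * (1 + 1 / K ^ m * (fact m * B ^ m))) * emeasure ?N Q"
  proof -
    have "ennreal (K powr p * (1 + 1 / K ^ m * (fact m * B ^ m)))
      = ennreal (K powr p) * (1 + ennreal (1 / K ^ m) * ennreal (fact m * B ^ m))"
      using K \<open>0 < B\<close> by (simp add: ennreal_mult ennreal_plus del: times_divide_eq_left)
    then show ?thesis by (simp add: algebra_simps)
  qed
  also have "\<dots> \<le> ennreal ((4 * p * B) powr p) * emeasure ?N Q"
  proof (intro mult_right_mono ennreal_leI)
    have "fact m \<le> real m ^ m"
      using fact_le_power[of m, where 'a=real] by simp
    then have "1 / K ^ m * (fact m * B ^ m) \<le> 1"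
      using K \<open>0 < B\<close> by (simp add: K_def power_mult_distrib divide_simps)
    then have "K powr p * (1 + 1 / K ^ m * (fact m * B ^ m)) \<le> K powr p * 2"
      by (intro mult_left_mono) auto
    also have "\<dots> \<le> K powr p * 2 powr p"
      using \<open>1 \<le> p\<close> powr_mono[of 1 p 2] by (intro mult_left_mono) auto
    also have "\<dots> = (K * 2) powr p"
      using K by (simp add: powr_mult)
    also have "\<dots> \<le> (4 * p * B) powr p"
      using K m \<open>0 < B\<close> \<open>1 \<le> p\<close> by (intro powr_mono2) (auto simp: K_def)
    finally show "K powr p * (1 + 1 / K ^ m * (fact m * B ^ m)) \<le> (4 * p * B) powr p" .
  qed simp
  finally show ?thesis .
qed

end

section \<open>Dyadic cubes\<close>

lemma cube_eq_cbox: "cube (a::real^'n) h = cbox a (\<chi> i. a $ i + h)"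
  unfolding cube_def Cart_1[symmetric] by (intro arg_cong[where f="cbox a"]) (simp add: vec_eq_iff)

lemma cube_nonempty: "0 \<le> h \<Longrightarrow> cube a h \<noteq> {}"
  unfolding cube_eq_cbox by (subst interval_ne_empty_cart) simp

lemma mem_cube: "x \<in> cube a h \<longleftrightarrow> (\<forall>i. a $ i \<le> x $ i \<and> x $ i \<le> a $ i + h)"
  by (simp add: cube_eq_cbox mem_box_cart)

lemma measure_cube: "h > 0 \<Longrightarrow> measure lebesgue (cube (a::real^'n) h) = h ^ CARD('n)"
  using cube_nonempty[of h a] unfolding cube_eq_cbox by (simp add: content_cbox_cart)

lemma lmeasurable_cube [simp]: "cube a h \<in> lmeasurable"
  by (simp add: cube_def)

text \<open>\<open>dyadic_desc\<close> quantifies over every corner and side length representing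
  \<open>Q\<close>; uniqueness of these allows one representation to be fixed.\<close>

lemma cube_inject:
  assumes "cube a h = cube b g" "h > 0" "g > 0"
  shows "a = b \<and> h = g"
proof -
  have "a = b \<and> (\<chi> i. a $ i + h) = (\<chi> i. b $ i + g)"
    using assms(1) cube_nonempty[of h a] \<open>h > 0\<close> unfolding cube_eq_cbox eq_cbox by auto
  then show ?thesis by (auto simp: vec_eq_iff)
qed

text \<open>Natural number indices replace the real vector in \<open>dyadic_desc\<close>, so that
  passing to an ancestor becomes integer division by a power of two.\<close>

definition dyadic_cube :: "real^'n \<Rightarrow> real \<Rightarrow> nat \<Rightarrow> ('n \<Rightarrow> nat) \<Rightarrow> (real^'n) set" where
  "dyadic_cube a h k j = cube (a + (h / 2 ^ k) *\<^sub>R (\<chi> i. real (j i))) (h / 2 ^ k)"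

lemma dyadic_desc_cube:
  assumes "h > 0"
  shows "dyadic_desc (cube a h) = {dyadic_cube a h k j | k j. \<forall>i. j i < 2 ^ k}"
proof (intro subset_antisym subsetI)
  fix R assume "R \<in> dyadic_desc (cube a h)"
  then obtain b g k j where *: "g > 0" "cube a h = cube b g"
      "\<forall>i. \<exists>m::nat. j $ i = real m \<and> m < 2 ^ k"
      "R = cube (b + (g / 2 ^ k) *\<^sub>R j) (g / 2 ^ k)"
    unfolding dyadic_desc_def by blast
  then obtain m where m: "\<forall>i. j $ i = real (m i) \<and> m i < 2 ^ k" by metis
  then have j: "j = (\<chi> i. real (m i))" by (simp add: vec_eq_iff)
  have "b = a" "g = h" using cube_inject[OF *(2) assms *(1)] by simp_all
  then have "R = dyadic_cube a h k m" unfolding *(4) j dyadic_cube_def by simp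
  with m show "R \<in> {dyadic_cube a h k j | k j. \<forall>i. j i < 2 ^ k}" by blast
next
  fix R assume "R \<in> {dyadic_cube a h k j | k j. \<forall>i. j i < 2 ^ k}"
  then obtain k j where *: "\<forall>i. j i < 2 ^ k" "R = dyadic_cube a h k j" by auto
  show "R \<in> dyadic_desc (cube a h)"
    unfolding dyadic_desc_def
    by (rule CollectI, rule exI[of _ a], rule exI[of _ h], rule exI[of _ k], rule exI[of _ "\<chi> i. real (j i)"])
      (use * assms in \<open>auto simp: dyadic_cube_def\<close>)
qed

lemma mem_dyadic_cube:
  "x \<in> dyadic_cube a h k j \<longleftrightarrow>
    (\<forall>i. a $ i + h / 2 ^ k * real (j i) \<le> x $ i \<and> x $ i \<le> a $ i + h / 2 ^ k * real (j i + 1))"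
  unfolding dyadic_cube_def mem_cube by (simp add: algebra_simps add_divide_distrib)

lemma measure_dyadic_cube:
  "h > 0 \<Longrightarrow> measure lebesgue (dyadic_cube (a::real^'n) h k j) = (h / 2 ^ k) ^ CARD('n)"
  unfolding dyadic_cube_def by (simp add: measure_cube)

lemma dyadic_cube_corner_eq:
  "k \<le> l \<Longrightarrow> h / 2 ^ k * real j = h / 2 ^ l * real (2 ^ (l - k) * j)"
  using power_add[of "2::real" k "l - k"] by (simp add: field_simps)

lemma dyadic_cube_subset:
  assumes "h > 0" "k \<le> l" "\<And>i. m i div 2 ^ (l - k) = j i"
  shows "dyadic_cube a h l m \<subseteq> dyadic_cube a h k j"
proof
  fix x assume x: "x \<in> dyadic_cube a h l m"
  show "x \<in> dyadic_cube a h k j"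
    unfolding mem_dyadic_cube
  proof
    fix i
    let ?d = "2 ^ (l - k) :: nat"
    have x': "a $ i + h / 2 ^ l * real (m i) \<le> x $ i" "x $ i \<le> a $ i + h / 2 ^ l * real (m i + 1)"
      using x unfolding mem_dyadic_cube by blast+
    have j: "j i = m i div ?d" using assms(3) by simp
    \<comment> \<open>Over the integers \<open>m i < ?d * j i + ?d\<close> sharpens to
      \<open>m i + 1 \<le> ?d * (j i + 1)\<close>, which controls the right face of the smaller
      cube.\<close>
    have "?d * j i \<le> m i" "m i < ?d * j i + ?d"
      unfolding j using dividend_less_times_div[of ?d "m i"] by simp_all
    then have "?d * j i \<le> m i" "m i + 1 \<le> ?d * (j i + 1)"
      by simp_all
    then have "h / 2 ^ l * real (?d * j i) \<le> h / 2 ^ l * real (m i)"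
      "h / 2 ^ l * real (m i + 1) \<le> h / 2 ^ l * real (?d * (j i + 1))"
      using \<open>h > 0\<close> by (simp_all only: mult_left_mono of_nat_le_iff divide_nonneg_nonneg less_imp_le zero_le_power zero_le_numeral)
    with x' show "a $ i + h / 2 ^ k * real (j i) \<le> x $ i \<and> x $ i \<le> a $ i + h / 2 ^ k * real (j i + 1)"
      unfolding dyadic_cube_corner_eq[OF \<open>k \<le> l\<close>] by linarith
  qed
qed

text \<open>If every index of the finer cube divides down to that of the coarser one, inclusion
  holds. Otherwise some coordinate projections share at most an endpoint, and the intersection lies
  in a hyperplane.\<close>

lemma dyadic_cube_subset_or_null:
  fixes a :: "real^'n"
  assumes "h > 0" "k \<le> l"
  shows "dyadic_cube a h l m \<subseteq> dyadic_cube a h k j \<or>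
    dyadic_cube a h l m \<inter> dyadic_cube a h k j \<in> null_sets lebesgue"
proof (cases "\<forall>i. m i div 2 ^ (l - k) = j i")
  case True
  then show ?thesis using dyadic_cube_subset[OF assms] by blast
next
  case False
  let ?d = "2 ^ (l - k) :: nat"
  from False obtain i where i: "m i div ?d \<noteq> j i" by blast
  have coord: "h / 2 ^ l * real (?d * j i) \<le> x $ i - a $ i" "x $ i - a $ i \<le> h / 2 ^ l * real (?d * (j i + 1))"
      "h / 2 ^ l * real (m i) \<le> x $ i - a $ i" "x $ i - a $ i \<le> h / 2 ^ l * real (m i + 1)"
    if "x \<in> dyadic_cube a h l m \<inter> dyadic_cube a h k j" for x
  proof -
    have "a $ i + h / 2 ^ l * real (m i) \<le> x $ i \<and> x $ i \<le> a $ i + h / 2 ^ l * real (m i + 1)"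
      "a $ i + h / 2 ^ k * real (j i) \<le> x $ i \<and> x $ i \<le> a $ i + h / 2 ^ k * real (j i + 1)"
      using that unfolding Int_iff mem_dyadic_cube by blast+
    then show "h / 2 ^ l * real (?d * j i) \<le> x $ i - a $ i" "x $ i - a $ i \<le> h / 2 ^ l * real (?d * (j i + 1))"
      "h / 2 ^ l * real (m i) \<le> x $ i - a $ i" "x $ i - a $ i \<le> h / 2 ^ l * real (m i + 1)"
      unfolding dyadic_cube_corner_eq[OF \<open>k \<le> l\<close>] by linarith+
  qed
  have mono: "h / 2 ^ l * real p \<le> h / 2 ^ l * real q" if "p \<le> q" for p q
    using that \<open>h > 0\<close> by (intro mult_left_mono) auto
  have "\<exists>c. dyadic_cube a h l m \<inter> dyadic_cube a h k j \<subseteq> {x. x $ i = c}"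
  proof (cases "m i div ?d < j i")
    case True
    then have "m i < j i * ?d" by (simp add: div_less_iff_less_mult)
    then have "h / 2 ^ l * real (m i + 1) \<le> h / 2 ^ l * real (?d * j i)"
      by (intro mono) (simp add: mult.commute)
    then have "x $ i = a $ i + h / 2 ^ l * real (?d * j i)" if "x \<in> dyadic_cube a h l m \<inter> dyadic_cube a h k j" for x
      using coord[OF that] by linarith
    then show ?thesis by blast
  next
    case False
    with i have "j i + 1 \<le> m i div ?d" by simp
    then have "(j i + 1) * ?d \<le> m i" by (simp add: less_eq_div_iff_mult_less_eq)
    then have "h / 2 ^ l * real (?d * (j i + 1)) \<le> h / 2 ^ l * real (m i)"
      by (intro mono) (simp add: mult.commute)
    then have "x $ i = a $ i + h / 2 ^ l * real (m i)" if "x \<in> dyadic_cube a h l m \<inter> dyadic_cube a h k j" for x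
      using coord[OF that] by linarith
    then show ?thesis by blast
  qed
  then obtain c where "dyadic_cube a h l m \<inter> dyadic_cube a h k j \<subseteq> {x. x $ i = c}" by blast
  moreover have "negligible {x::real^'n. x $ i = c}"
    using negligible_standard_hyperplane[of "axis i 1 :: real^'n" c]
    by (simp add: inner_axis axis_in_Basis_iff)
  ultimately show ?thesis
    unfolding negligible_iff_null_sets[symmetric] using negligible_subset by metis
qed

lemma dyadic_desc_cases:
  assumes "is_cube Q"
  obtains a h where "h > 0" "Q = cube a h"
    "dyadic_desc Q = {dyadic_cube a h k j | k j. \<forall>i. j i < 2 ^ k}"
  using assms dyadic_desc_cube unfolding is_cube_def by blast

lemma dyadic_cube_is_cube: "h > 0 \<Longrightarrow> is_cube (dyadic_cube a h k j)"
  unfolding is_cube_def dyadic_cube_def by (rule exI, rule exI[of _ "h / 2 ^ k"]) auto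

lemma dyadic_desc_is_cube:
  assumes "is_cube Q" "R \<in> dyadic_desc Q"
  shows "is_cube R"
proof -
  obtain a h where "h > 0" "dyadic_desc Q = {dyadic_cube a h k j | k j. \<forall>i. j i < 2 ^ k}"
    using assms(1) by (rule dyadic_desc_cases)
  with assms(2) show ?thesis by (auto intro: dyadic_cube_is_cube)
qed

lemma is_cube_lmeasurable: "is_cube R \<Longrightarrow> R \<in> lmeasurable"
  unfolding is_cube_def by auto

lemma is_cube_compact: "is_cube R \<Longrightarrow> compact R"
  unfolding is_cube_def cube_def by auto

lemma is_cube_measure_pos: "is_cube R \<Longrightarrow> 0 < measure lebesgue R"
  unfolding is_cube_def by (auto simp: measure_cube)

lemma self_in_dyadic_desc: "is_cube Q \<Longrightarrow> Q \<in> dyadic_desc Q"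
proof -
  assume "is_cube Q"
  then obtain a h where ah: "h > 0" "Q = cube a h"
    "dyadic_desc Q = {dyadic_cube a h k j | k j. \<forall>i. j i < 2 ^ k}"
    by (rule dyadic_desc_cases)
  have "Q = dyadic_cube a h 0 (\<lambda>_. 0)"
    unfolding ah(2) dyadic_cube_def by (simp add: zero_vec_def[symmetric])
  then show ?thesis
    unfolding ah(3) by (intro CollectI exI[of _ "0::nat"] exI[of _ "\<lambda>_. 0"]) auto
qed

lemma finite_dyadic_generation:
  "finite {dyadic_cube a h k (j :: 'n::finite \<Rightarrow> nat) | j. \<forall>i. j i < 2 ^ k}"
proof -
  have "{j :: 'n \<Rightarrow> nat. \<forall>i. j i < 2 ^ k} = PiE UNIV (\<lambda>_. {..<2 ^ k})"
    by (auto simp: PiE_def)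
  then have "finite {j :: 'n \<Rightarrow> nat. \<forall>i. j i < 2 ^ k}"
    by (simp add: finite_PiE)
  then show ?thesis by simp
qed

text \<open>Inclusion compares volumes, and a later generation has strictly smaller volume.\<close>

lemma dyadic_cube_generation_le:
  assumes "h > 0" "dyadic_cube (a::real^'n) h l m \<subseteq> dyadic_cube a h k j"
  shows "k \<le> l"
proof (rule ccontr)
  assume "\<not> k \<le> l"
  then have "h / 2 ^ k < h / 2 ^ l"
    using \<open>h > 0\<close> by (intro divide_strict_left_mono) auto
  then have "(h / 2 ^ k) ^ CARD('n) < (h / 2 ^ l) ^ CARD('n)"
    using \<open>h > 0\<close> by (intro power_strict_mono) auto
  moreover have "measure lebesgue (dyadic_cube a h l m) \<le> measure lebesgue (dyadic_cube a h k j)"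
    using assms(2) unfolding dyadic_cube_def by (intro measure_mono_fmeasurable) (auto intro: fmeasurableD)
  ultimately show False using \<open>h > 0\<close> by (simp only: measure_dyadic_cube)
qed

lemma is_cube_not_null: "is_cube R \<Longrightarrow> R \<subseteq> N \<Longrightarrow> N \<notin> null_sets lebesgue"
  using is_cube_measure_pos is_cube_lmeasurable
  by (metis less_irrefl measure_eq_0_null_sets null_sets_subset fmeasurableD)

text \<open>Halving the indices of \<open>R\<close> gives its parent \<open>P\<close>. The parent
  meets \<open>T\<close> in a set containing \<open>R\<close>, hence not in a null set, so
  nestedness places it inside \<open>T\<close>. The lemma compares a maximal stopping cube with a
  parent that fails to stop.\<close>

lemma dyadic_parent:
  assumes Q: "is_cube (Q::(real^'n) set)" and R: "R \<in> dyadic_desc Q" and T: "T \<in> dyadic_desc Q"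
    and RT: "R \<subset> T"
  obtains P where "P \<in> dyadic_desc Q" "R \<subset> P" "P \<subseteq> T"
    "measure lebesgue P = 2 ^ CARD('n) * measure lebesgue R"
proof -
  obtain a h where ah: "h > 0" "Q = cube a h"
    "dyadic_desc Q = {dyadic_cube a h k j | k j. \<forall>i. j i < 2 ^ k}"
    using Q by (rule dyadic_desc_cases)
  obtain l m where m: "R = dyadic_cube a h l m" "\<And>i. m i < 2 ^ l" using R ah by auto
  obtain k j where j: "T = dyadic_cube a h k j" "\<And>i. j i < 2 ^ k" using T ah by auto
  have kl: "k \<le> l" using dyadic_cube_generation_le[OF ah(1)] RT m j by blast
  have notnull: "R \<subseteq> N \<Longrightarrow> N \<notin> null_sets lebesgue" for N
    using is_cube_not_null dyadic_cube_is_cube[OF ah(1)] m by blast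
  \<comment> \<open>In equal generations \<open>T\<close> would lie in \<open>R\<close> or meet it
    in a null set; proper inclusion excludes the first, positive measure of \<open>R\<close> the
    second.\<close>
  have "k \<noteq> l"
  proof
    assume "k = l"
    then have "T \<subseteq> R \<or> T \<inter> R \<in> null_sets lebesgue"
      unfolding m j using dyadic_cube_subset_or_null[OF ah(1)] by blast
    with RT notnull[of "T \<inter> R"] show False by blast
  qed
  with kl obtain l' where l': "l = Suc l'" "k \<le> l'" by (cases l) auto
  define P where "P = dyadic_cube a h l' (\<lambda>i. m i div 2)"
  have "m i div 2 < 2 ^ l'" for i using m(2)[of i] l' by (simp add: less_mult_imp_div_less)
  then have PD: "P \<in> dyadic_desc Q" unfolding P_def ah(3) by blast
  have RP: "R \<subseteq> P" unfolding m P_def using l' by (intro dyadic_cube_subset ah) auto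
  have PT: "P \<subseteq> T"
    using dyadic_cube_subset_or_null[OF ah(1) l'(2), of a "\<lambda>i. m i div 2" j] notnull[of "P \<inter> T"] RP RT
    unfolding P_def j by blast
  have meas: "measure lebesgue P = 2 ^ CARD('n) * measure lebesgue R"
    unfolding P_def m l' using ah(1) by (simp add: measure_dyadic_cube power_mult_distrib power_divide)
  have "2 ^ 1 \<le> (2::real) ^ CARD('n)"
    by (intro power_increasing) (auto simp: Suc_le_eq)
  then have "R \<noteq> P"
    using meas is_cube_measure_pos[OF dyadic_desc_is_cube[OF Q R]] by auto
  with RP PT PD meas show ?thesis using that by blast
qed

lemma countable_dyadic_desc:
  assumes "is_cube Q"
  shows "countable (dyadic_desc Q)"
proof -
  obtain a h where ah: "h > 0" "Q = cube a h"
    "dyadic_desc Q = {dyadic_cube a h k j | k j. \<forall>i. j i < 2 ^ k}"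
    using assms by (rule dyadic_desc_cases)
  have "dyadic_desc Q = (\<Union>k. {dyadic_cube a h k j | j. \<forall>i. j i < 2 ^ k})"
    unfolding ah(3) by blast
  then show ?thesis
    by (simp add: countable_finite finite_dyadic_generation)
qed

lemma finite_dyadic_ancestors:
  assumes "is_cube Q" "R \<in> dyadic_desc Q"
  shows "finite {S \<in> dyadic_desc Q. R \<subseteq> S}"
proof -
  obtain a h where ah: "h > 0" "Q = cube a h"
    "dyadic_desc Q = {dyadic_cube a h k j | k j. \<forall>i. j i < 2 ^ k}"
    using assms(1) by (rule dyadic_desc_cases)
  obtain l m where m: "R = dyadic_cube a h l m" using assms(2) ah by auto
  have "{S \<in> dyadic_desc Q. R \<subseteq> S} \<subseteq> (\<Union>k\<le>l. {dyadic_cube a h k j | j. \<forall>i. j i < 2 ^ k})"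
    unfolding ah(3) m using dyadic_cube_generation_le[OF ah(1)] by blast
  then show ?thesis
    by (rule finite_subset) (auto intro: finite_dyadic_generation)
qed

lemma dyadic_desc_subset:
  assumes "is_cube Q" "R \<in> dyadic_desc Q"
  shows "R \<subseteq> Q"
proof -
  obtain a h where ah: "h > 0" "Q = cube a h"
    "dyadic_desc Q = {dyadic_cube a h k j | k j. \<forall>i. j i < 2 ^ k}"
    using assms(1) by (rule dyadic_desc_cases)
  then obtain k j where R: "R = dyadic_cube a h k j" "\<And>i. j i < 2 ^ k" using assms(2) by auto
  have "R \<subseteq> dyadic_cube a h 0 (\<lambda>_. 0)"
    unfolding R(1) by (rule dyadic_cube_subset[OF ah(1)]) (use R(2) in simp_all)
  also have "dyadic_cube a h 0 (\<lambda>_. 0) = Q"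
    unfolding ah(2) dyadic_cube_def by (simp add: zero_vec_def[symmetric])
  finally show ?thesis .
qed

lemma dyadic_desc_nested:
  assumes "is_cube Q" "R \<in> dyadic_desc Q" "S \<in> dyadic_desc Q"
  shows "R \<subseteq> S \<or> S \<subseteq> R \<or> R \<inter> S \<in> null_sets lebesgue"
proof -
  obtain a h where ah: "h > 0" "Q = cube a h"
    "dyadic_desc Q = {dyadic_cube a h k j | k j. \<forall>i. j i < 2 ^ k}"
    using assms(1) by (rule dyadic_desc_cases)
  then obtain k j l m where "R = dyadic_cube a h k j" "S = dyadic_cube a h l m"
    using assms by auto
  then show ?thesis
    using dyadic_cube_subset_or_null[OF ah(1), of k l] dyadic_cube_subset_or_null[OF ah(1), of l k]
      nat_le_linear[of k l] by (metis Int_commute)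
qed

section \<open>Mean oscillation and the stopping cubes\<close>

lemma is_cube_sets [simp]: "is_cube R \<Longrightarrow> R \<in> sets lebesgue"
  using is_cube_lmeasurable by (blast intro: fmeasurableD)

lemma emeasure_is_cube: "is_cube R \<Longrightarrow> emeasure lebesgue R = ennreal (measure lebesgue R)"
  using is_cube_lmeasurable by (blast intro: emeasure_eq_measure2)

lemma ennreal_inverse_measure:
  assumes "is_cube R"
  shows "ennreal (1 / measure lebesgue R) * emeasure lebesgue R = 1"
  using is_cube_measure_pos[OF assms]
  by (simp add: emeasure_is_cube[OF assms] flip: ennreal_mult)

text \<open>Brings averages into the quotient form used for the abstract nested family.\<close>

lemma mean_abs_eq_divide:
  assumes R: "is_cube R" and g: "g \<in> borel_measurable lebesgue"
  shows "mean_abs g R = emeasure (density lebesgue (\<lambda>x. ennreal \<bar>g x\<bar>)) R / emeasure lebesgue R"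
proof -
  have "inverse (emeasure lebesgue R) = ennreal (1 / measure lebesgue R)"
    using is_cube_measure_pos[OF R]
    by (simp add: emeasure_is_cube[OF R] inverse_ennreal inverse_eq_divide)
  then show ?thesis
    using g R by (simp add: mean_abs_def divide_ennreal_def emeasure_density mult.commute)
qed

lemma mean_abs_triangle:
  assumes R: "is_cube R" and f [measurable]: "f \<in> borel_measurable lebesgue"
  shows "mean_abs (\<lambda>y. f y - c) R \<le> mean_abs (\<lambda>y. f y - d) R + ennreal \<bar>d - c\<bar>"
proof -
  have [measurable]: "R \<in> sets lebesgue" using R by simp
  have "(\<integral>\<^sup>+y\<in>R. ennreal \<bar>f y - c\<bar> \<partial>lebesgue)
      \<le> (\<integral>\<^sup>+y. ennreal \<bar>f y - d\<bar> * indicator R y + ennreal \<bar>d - c\<bar> * indicator R y \<partial>lebesgue)"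
    by (intro nn_integral_mono) (auto split: split_indicator simp flip: ennreal_plus intro!: ennreal_leI)
  also have "\<dots> = (\<integral>\<^sup>+y\<in>R. ennreal \<bar>f y - d\<bar> \<partial>lebesgue) + ennreal \<bar>d - c\<bar> * emeasure lebesgue R"
    by (subst nn_integral_add) (auto simp: nn_integral_cmult)
  finally have "mean_abs (\<lambda>y. f y - c) R \<le> ennreal (1 / measure lebesgue R) *
      ((\<integral>\<^sup>+y\<in>R. ennreal \<bar>f y - d\<bar> \<partial>lebesgue) + ennreal \<bar>d - c\<bar> * emeasure lebesgue R)"
    unfolding mean_abs_def by (intro mult_left_mono) auto
  also have "\<dots> = mean_abs (\<lambda>y. f y - d) R
      + ennreal \<bar>d - c\<bar> * (ennreal (1 / measure lebesgue R) * emeasure lebesgue R)"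
    unfolding mean_abs_def by (simp only: distrib_left mult_ac)
  finally show ?thesis by (simp only: ennreal_inverse_measure[OF R] mult_1_right)
qed

text \<open>The left side is the modulus of the average of \<open>f - c\<close> over
  \<open>R\<close>; local integrability makes the Bochner integral split, and the modulus then
  passes inside.\<close>

lemma avg_diff_le_mean_abs:
  assumes R: "is_cube R" and f: "locally_integrable f"
  shows "ennreal \<bar>avg f R - c\<bar> \<le> mean_abs (\<lambda>y. f y - c) R"
proof -
  let ?m = "measure lebesgue R"
  have m: "0 < ?m" using is_cube_measure_pos[OF R] .
  have int_f: "integrable lebesgue (\<lambda>y. indicator R y *\<^sub>R f y)"
    using f is_cube_compact[OF R] unfolding locally_integrable_def set_integrable_def by blast
  have int_c: "integrable lebesgue (\<lambda>y. indicator R y *\<^sub>R c)"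
    using is_cube_lmeasurable[OF R]
    by (intro integrable_scaleR_left impI) (auto simp: fmeasurable_def)
  have eq: "(\<lambda>y. indicator R y *\<^sub>R (f y - c)) = (\<lambda>y. indicator R y *\<^sub>R f y - indicator R y *\<^sub>R c)"
    by (simp add: right_diff_distrib)
  have int_d: "integrable lebesgue (\<lambda>y. indicator R y *\<^sub>R (f y - c))"
    unfolding eq using int_f int_c by (rule Bochner_Integration.integrable_diff)
  have "(\<integral>y. indicator R y *\<^sub>R (f y - c) \<partial>lebesgue) = (avg f R - c) * ?m"
    unfolding eq Bochner_Integration.integral_diff[OF int_f int_c]
    using m by (simp add: avg_def set_lebesgue_integral_def algebra_simps)
  then have "ennreal (\<bar>avg f R - c\<bar> * ?m) = ennreal (norm (\<integral>y. indicator R y *\<^sub>R (f y - c) \<partial>lebesgue))"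
    using m by (simp add: abs_mult)
  also have "\<dots> \<le> (\<integral>\<^sup>+y. ennreal (norm (indicator R y *\<^sub>R (f y - c))) \<partial>lebesgue)"
    using integral_norm_bound_ennreal[OF int_d] .
  also have "\<dots> = (\<integral>\<^sup>+y\<in>R. ennreal \<bar>f y - c\<bar> \<partial>lebesgue)"
    by (intro nn_integral_cong) (auto split: split_indicator)
  finally have "ennreal (1 / ?m) * ennreal (\<bar>avg f R - c\<bar> * ?m) \<le> mean_abs (\<lambda>y. f y - c) R"
    unfolding mean_abs_def by (intro mult_left_mono) auto
  moreover have "ennreal (1 / ?m) * ennreal (\<bar>avg f R - c\<bar> * ?m) = ennreal \<bar>avg f R - c\<bar>"
    using m by (simp flip: ennreal_mult)
  ultimately show ?thesis by simp
qed

lemma mean_abs_subset: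
  assumes "is_cube R" "R \<subseteq> P" "measure lebesgue P = K * measure lebesgue R" "0 < K"
  shows "mean_abs g R \<le> ennreal K * mean_abs g P"
proof -
  have "ennreal (1 / measure lebesgue R) = ennreal K * ennreal (1 / measure lebesgue P)"
    using assms is_cube_measure_pos[OF assms(1)] by (simp flip: ennreal_mult)
  moreover have "(\<integral>\<^sup>+y\<in>R. ennreal \<bar>g y\<bar> \<partial>lebesgue) \<le> (\<integral>\<^sup>+y\<in>P. ennreal \<bar>g y\<bar> \<partial>lebesgue)"
    using assms(2) by (intro nn_integral_mono) (auto split: split_indicator)
  ultimately show ?thesis
    unfolding mean_abs_def mult.assoc[symmetric] by (intro mult_mono) auto
qed

lemma mean_abs_le_sharp_max:
  "is_cube R \<Longrightarrow> x \<in> R \<Longrightarrow> mean_abs (\<lambda>y. f y - avg f R) R \<le> sharp_max f x"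
  unfolding sharp_max_def by (intro SUP_upper) auto

text \<open>For bounded \<open>t\<close> the supremum is a finite limit and the power is continuous.
  For unbounded \<open>t\<close> the terms eventually exceed 1, where
  \<open>t n \<le> t n powr p\<close>, so the right side is \<open>top\<close>, matching the
  convention of \<open>ennpow\<close> at \<open>top\<close>.\<close>

lemma ennpow_le_SUP:
  assumes x: "x \<le> (SUP n. ennreal (t n))" and t: "\<And>n. 0 \<le> t n" "incseq t" and "1 \<le> p"
  shows "ennpow x p \<le> (SUP n. ennreal (t n powr p))"
proof (cases "bdd_above (range t)")
  case True
  define s where "s = (SUP n. t n)"
  have lim: "t \<longlonglongrightarrow> s"
    unfolding s_def using LIMSEQ_incseq_SUP[OF True t(2)] .
  have s0: "0 \<le> s" using LIMSEQ_le_const[OF lim] t(1) by blast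
  have "(SUP n. ennreal (t n)) = ennreal s"
    using lim t by (intro LIMSEQ_unique[OF LIMSEQ_SUP]) (auto simp: incseq_def intro!: ennreal_leI)
  with x have "x \<le> ennreal s" by simp
  then have "x < top" "enn2real x \<le> s"
    using s0 enn2real_leI by (auto simp: le_less_trans[OF _ ennreal_less_top])
  then have "ennpow x p \<le> ennreal (s powr p)"
    using \<open>1 \<le> p\<close> by (auto simp: ennpow_def intro!: ennreal_leI powr_mono2)
  moreover have "(\<lambda>n. ennreal (t n powr p)) \<longlonglongrightarrow> ennreal (s powr p)"
    using lim t(1) \<open>1 \<le> p\<close> by (intro tendsto_ennrealI tendsto_powr') auto
  then have "ennreal (s powr p) \<le> (SUP n. ennreal (t n powr p))"
    by (rule LIMSEQ_le_const2) (auto intro!: exI SUP_upper)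
  ultimately show ?thesis by (rule order_trans)
next
  case False
  have "(SUP n. ennreal (t n powr p)) = top"
  proof (rule ennreal_SUP_eq_top)
    fix m :: nat
    have "\<forall>M. \<exists>n. M < t n" using False by (auto simp: bdd_above_def not_le)
    then obtain n where "max 1 (real m) < t n" by blast
    moreover from this have "t n powr 1 \<le> t n powr p"
      using \<open>1 \<le> p\<close> by (intro powr_mono) auto
    ultimately have "real m \<le> t n powr p" by simp
    then show "\<exists>n\<in>UNIV. of_nat m \<le> ennreal (t n powr p)"
      unfolding ennreal_of_nat_eq_real_of_nat by (blast intro: ennreal_leI)
  qed
  then show ?thesis by (simp only: top_greatest)
qed

text \<open>The degenerate quotients are \<open>0 / 0 = 0\<close> and \<open>a / top = 0\<close>.\<close>

lemma ennreal_divide_le_of_le_mult: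
  assumes "a \<le> c * (b::ennreal)"
  shows "a / b \<le> c"
proof (cases "b = 0 \<or> b = top")
  case True
  with assms show ?thesis by auto
next
  case False
  have "a / b \<le> c * b / b"
    using assms by (rule divide_right_mono_ennreal)
  also have "\<dots> = c" using False by (simp add: mult_divide_eq_ennreal)
  finally show ?thesis .
qed

lemma nested_family_dyadic_desc:
  assumes Q: "is_cube Q"
  shows "nested_family lebesgue (dyadic_desc Q)"
proof
  fix R S assume R: "R \<in> dyadic_desc Q"
  then have cube: "is_cube R" using Q dyadic_desc_is_cube by blast
  then show "R \<in> sets lebesgue" by simp
  show "emeasure lebesgue R \<noteq> 0" "emeasure lebesgue R \<noteq> \<infinity>"
    unfolding emeasure_is_cube[OF cube] using is_cube_measure_pos[OF cube] by simp_all
  show "finite {S \<in> dyadic_desc Q. R \<subseteq> S}" using finite_dyadic_ancestors[OF Q R] .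
  show "R \<subseteq> S \<or> S \<subseteq> R \<or> R \<inter> S \<in> null_sets lebesgue" if "S \<in> dyadic_desc Q"
    using dyadic_desc_nested[OF Q R that] .
qed (rule countable_dyadic_desc[OF Q])

text \<open>In \<open>C\<close> the factor 4 is the stopping threshold and
  \<open>2 ^ CARD('n)\<close> is the loss in averages between a cube and its dyadic parent.\<close>

locale dyadic_oscillation =
  fixes f :: "real^'n \<Rightarrow> real" and Q :: "(real^'n) set" and C :: real
  assumes f_loc: "locally_integrable f" and Q_cube: "is_cube Q" and C_eq: "C = 4 * 2 ^ CARD('n)"
begin

lemma f_measurable [measurable]: "f \<in> borel_measurable lebesgue"
  using f_loc by (simp add: locally_integrable_def)

abbreviation dev :: "(real^'n) set \<Rightarrow> (real^'n) set \<Rightarrow> ennreal" where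
  "dev R S \<equiv> mean_abs (\<lambda>y. f y - avg f R) S"

text \<open>Centring at the average over \<open>R\<close> itself, not over \<open>Q\<close>, makes
  the threshold \<open>dev R R\<close> a mean oscillation, which \<open>sharp_max f\<close>
  dominates at every point of \<open>R\<close>.\<close>

definition stops :: "(real^'n) set \<Rightarrow> (real^'n) set set" where
  "stops R = {S\<in>dyadic_desc Q. S \<subset> R \<and> 4 * dev R R < dev R S}"

definition stopping_children :: "(real^'n) set \<Rightarrow> (real^'n) set set" where
  "stopping_children R = maximal_in (stops R)"

sublocale nested_family lebesgue "dyadic_desc Q"
  by (rule nested_family_dyadic_desc[OF Q_cube])

lemma desc_is_cube: "R \<in> dyadic_desc Q \<Longrightarrow> is_cube R"
  using dyadic_desc_is_cube[OF Q_cube] .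

lemma stops_subset: "stops R \<subseteq> dyadic_desc Q"
  unfolding stops_def by auto

sublocale stopping_family lebesgue "dyadic_desc Q" Q stopping_children
proof
  show "Q \<in> dyadic_desc Q" using self_in_dyadic_desc[OF Q_cube] .
  fix R assume R: "R \<in> dyadic_desc Q"
  show "stopping_children R \<subseteq> dyadic_desc Q"
    using stops_subset unfolding stopping_children_def maximal_in_def by auto
  show "S \<subset> R" if "S \<in> stopping_children R" for S
    using that unfolding stopping_children_def maximal_in_def stops_def by auto
  show "S \<inter> T \<in> null_sets lebesgue" if "S \<in> stopping_children R" "T \<in> stopping_children R" "S \<noteq> T" for S T
    using maximal_in_null_inter[OF stops_subset] that unfolding stopping_children_def by blast
  have "stops R = {S\<in>dyadic_desc Q. S \<subset> R \<and>
      4 * (emeasure (density lebesgue (\<lambda>y. ennreal \<bar>f y - avg f R\<bar>)) R / emeasure lebesgue R)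
      < emeasure (density lebesgue (\<lambda>y. ennreal \<bar>f y - avg f R\<bar>)) S / emeasure lebesgue S}"
    unfolding stops_def using R by (auto simp: mean_abs_eq_divide desc_is_cube)
  then show "2 * emeasure lebesgue (\<Union>(stopping_children R)) \<le> emeasure lebesgue R"
    unfolding stopping_children_def using R emeasure_Union_maximal_le[of "\<lambda>y. ennreal \<bar>f y - avg f R\<bar>" R]
    by simp
qed

lemma C_pos: "0 < C"
  by (simp add: C_eq)

lemma dev_le_of_not_stops:
  assumes "R \<in> dyadic_desc Q" "S \<in> dyadic_desc Q" "S \<subseteq> R" "S \<notin> stops R"
  shows "dev R S \<le> 4 * dev R R"
proof (cases "S = R")
  case True
  have "1 * dev R R \<le> 4 * dev R R" by (intro mult_right_mono) auto
  with True show ?thesis by simp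
next
  case False
  with assms show ?thesis unfolding stops_def by auto
qed

text \<open>By maximality of \<open>S\<close> its parent \<open>P\<close>, possibly \<open>R\<close>
  itself, does not stop, so the average over \<open>P\<close> is at most four times
  \<open>dev R R\<close>; restricting from \<open>P\<close> to \<open>S\<close> costs
  \<open>2 ^ CARD('n)\<close>.\<close>

lemma dev_stopping_child:
  assumes R: "R \<in> dyadic_desc Q" and S: "S \<in> stopping_children R"
  shows "dev R S \<le> ennreal C * dev R R"
proof -
  have S': "S \<in> dyadic_desc Q" "S \<subset> R" "S \<in> stops R" "\<And>T. T \<in> stops R \<Longrightarrow> S \<subseteq> T \<Longrightarrow> T = S"
    using S unfolding stopping_children_def maximal_in_def stops_def by auto
  from dyadic_parent[OF Q_cube S'(1) R S'(2)] obtain P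
    where P: "P \<in> dyadic_desc Q" "S \<subset> P" "P \<subseteq> R" "measure lebesgue P = 2 ^ CARD('n) * measure lebesgue S" .
  have "P \<notin> stops R" using S'(4)[of P] P by blast
  have "dev R S \<le> ennreal (2 ^ CARD('n)) * dev R P"
    using P by (intro mean_abs_subset desc_is_cube S') auto
  also have "\<dots> \<le> ennreal (2 ^ CARD('n)) * (4 * dev R R)"
    using dev_le_of_not_stops[OF R P(1,3) \<open>P \<notin> stops R\<close>] by (intro mult_left_mono) auto
  also have "\<dots> = ennreal (2 ^ CARD('n)) * ennreal 4 * dev R R"
    by (simp add: mult.assoc)
  also have "ennreal (2 ^ CARD('n)) * ennreal 4 = ennreal C"
    by (subst ennreal_mult[symmetric]) (auto simp: C_eq mult.commute)
  finally show ?thesis .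
qed

text \<open>Telescoping along the chain of stopping cubes from \<open>Q\<close> down to
  \<open>R\<close>: all of them contain \<open>x\<close>, and each step changes the average by at
  most \<open>C\<close> times the oscillation over the parent, hence by at most
  \<open>C * sharp_max f x\<close>.\<close>

lemma avg_layer_diff:
  assumes "R \<in> layer k" "x \<in> R"
  shows "ennreal \<bar>avg f R - avg f Q\<bar> \<le> ennreal (C * real k) * sharp_max f x"
  using assms
proof (induction k arbitrary: R)
  case 0
  then show ?case by simp
next
  case (Suc k)
  then obtain T where T: "T \<in> layer k" "R \<in> stopping_children T" by auto
  have TD: "T \<in> dyadic_desc Q" and RD: "R \<in> dyadic_desc Q"
    using T(1) Suc.prems(1) layer_subset_D by blast+
  have xT: "x \<in> T" using children_subset[OF TD T(2)] Suc.prems by blast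
  have "ennreal \<bar>avg f R - avg f Q\<bar> \<le> ennreal (\<bar>avg f R - avg f T\<bar> + \<bar>avg f T - avg f Q\<bar>)"
    by (intro ennreal_leI) simp
  also have "\<dots> = ennreal \<bar>avg f R - avg f T\<bar> + ennreal \<bar>avg f T - avg f Q\<bar>"
    by (rule ennreal_plus) auto
  also have "\<dots> \<le> ennreal C * sharp_max f x + ennreal (C * real k) * sharp_max f x"
  proof (rule add_mono)
    have "ennreal \<bar>avg f R - avg f T\<bar> \<le> dev T R"
      using avg_diff_le_mean_abs[OF desc_is_cube[OF RD] f_loc] .
    also have "\<dots> \<le> ennreal C * dev T T"
      using dev_stopping_child[OF TD T(2)] .
    also have "\<dots> \<le> ennreal C * sharp_max f x"
      using mean_abs_le_sharp_max[OF desc_is_cube[OF TD] xT] by (intro mult_left_mono) auto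
    finally show "ennreal \<bar>avg f R - avg f T\<bar> \<le> ennreal C * sharp_max f x" .
  qed (rule Suc.IH[OF T(1) xT])
  also have "\<dots> = ennreal (C * real (Suc k)) * sharp_max f x"
    using C_pos by (simp add: distrib_left ennreal_plus flip: distrib_right)
  finally show ?case .
qed

text \<open>Descend to a child as long as one contains \<open>S\<close>. This terminates because the
  finite number of dyadic cubes between \<open>S\<close> and the current cube strictly
  decreases.\<close>

lemma smallest_layer_cube:
  assumes "S \<in> dyadic_desc Q" "R \<in> layer k" "S \<subseteq> R"
  shows "\<exists>k R. R \<in> layer k \<and> S \<subseteq> R \<and> (\<forall>T\<in>stopping_children R. \<not> S \<subseteq> T)"
  using assms(2,3)
proof (induction "card {T\<in>dyadic_desc Q. S \<subseteq> T \<and> T \<subseteq> R}" arbitrary: R k rule: less_induct)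
  case less
  show ?case
  proof (cases "\<exists>T\<in>stopping_children R. S \<subseteq> T")
    case True
    then obtain T where T: "T \<in> stopping_children R" "S \<subseteq> T" by blast
    have RD: "R \<in> dyadic_desc Q" using less.prems layer_subset_D by blast
    have TR: "T \<subset> R" using children_subset[OF RD T(1)] .
    have "{U\<in>dyadic_desc Q. S \<subseteq> U \<and> U \<subseteq> T} \<subset> {U\<in>dyadic_desc Q. S \<subseteq> U \<and> U \<subseteq> R}"
      using TR RD less.prems by blast
    moreover have "finite {U\<in>dyadic_desc Q. S \<subseteq> U \<and> U \<subseteq> R}"
      by (rule finite_subset[OF _ finite_ancestors[OF assms(1)]]) auto
    ultimately have "card {U\<in>dyadic_desc Q. S \<subseteq> U \<and> U \<subseteq> T} < card {U\<in>dyadic_desc Q. S \<subseteq> U \<and> U \<subseteq> R}"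
      by (rule psubset_card_mono[rotated])
    moreover have "T \<in> layer (Suc k)" using less.prems T by auto
    ultimately show ?thesis using less.hyps T(2) by blast
  next
    case False
    then show ?thesis using less.prems by blast
  qed
qed

lemma depth_full: "x \<in> level k \<Longrightarrow> depth 0 (Suc k) x = real (Suc k)"
proof -
  assume "x \<in> level k"
  then have "indicat_real (level i) x = 1" if "i \<in> {0..<Suc k}" for i
    using level_antimono[of i k] that by (auto simp: indicator_def)
  then show ?thesis unfolding depth_def by simp
qed

text \<open>Let \<open>R\<close> in layer \<open>k\<close> be a last stopping cube containing
  \<open>S\<close>. Then \<open>S\<close> does not stop below \<open>R\<close>, since a maximal
  stopping cube above it would be a child containing \<open>S\<close>. So \<open>dev R S\<close>
  costs one multiple of \<open>C * sharp_max f x\<close>, and recentring from \<open>R\<close> to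
  \<open>Q\<close> costs \<open>k\<close> more. The total \<open>k + 1\<close> is the depth of
  \<open>x\<close>, which lies in levels \<open>0\<close> to \<open>k\<close>.\<close>

lemma mean_abs_le_depth:
  assumes S: "S \<in> dyadic_desc Q" and x: "x \<in> S"
  shows "\<exists>L. dev Q S \<le> ennreal (C * depth 0 L x) * sharp_max f x"
proof -
  have "Q \<in> layer 0" "S \<subseteq> Q"
    using dyadic_desc_subset[OF Q_cube S] by auto
  from smallest_layer_cube[OF S this] obtain k R
    where R: "R \<in> layer k" "S \<subseteq> R" "\<forall>T\<in>stopping_children R. \<not> S \<subseteq> T" by blast
  have RD: "R \<in> dyadic_desc Q" using R(1) layer_subset_D by blast
  have "S \<notin> stops R"
    using maximal_in_exists[OF stops_subset] R(3) unfolding stopping_children_def by blast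
  have "dev Q S \<le> dev R S + ennreal \<bar>avg f R - avg f Q\<bar>"
    by (intro mean_abs_triangle desc_is_cube S f_measurable)
  also have "\<dots> \<le> ennreal C * sharp_max f x + ennreal (C * real k) * sharp_max f x"
  proof (rule add_mono)
    have "dev R S \<le> 4 * dev R R"
      using dev_le_of_not_stops[OF RD S R(2) \<open>S \<notin> stops R\<close>] .
    also have "\<dots> \<le> ennreal C * sharp_max f x"
    proof (rule mult_mono)
      have "ennreal 4 \<le> ennreal C" unfolding C_eq by (intro ennreal_leI) simp
      then show "4 \<le> ennreal C" by simp
      show "dev R R \<le> sharp_max f x"
        using R(2) x by (intro mean_abs_le_sharp_max desc_is_cube RD) auto
    qed auto
    finally show "dev R S \<le> ennreal C * sharp_max f x" .
    show "ennreal \<bar>avg f R - avg f Q\<bar> \<le> ennreal (C * real k) * sharp_max f x"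
      using R x by (intro avg_layer_diff) auto
  qed
  also have "\<dots> = ennreal (C * real (Suc k)) * sharp_max f x"
    using C_pos by (simp add: distrib_left ennreal_plus flip: distrib_right)
  also have "real (Suc k) = depth 0 (Suc k) x"
    using R x by (intro depth_full[symmetric]) (auto simp: level_def)
  finally show ?thesis by blast
qed

lemma ratio_le_depth:
  "loc_dyadic_max Q (\<lambda>y. f y - avg f Q) x / sharp_max f x \<le> (SUP L. ennreal (C * depth 0 L x))"
proof (rule ennreal_divide_le_of_le_mult)
  show "loc_dyadic_max Q (\<lambda>y. f y - avg f Q) x \<le> (SUP L. ennreal (C * depth 0 L x)) * sharp_max f x"
    unfolding loc_dyadic_max_def
  proof (rule SUP_least)
    fix S assume "S \<in> {R \<in> dyadic_desc Q. x \<in> R}"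
    then obtain L where "dev Q S \<le> ennreal (C * depth 0 L x) * sharp_max f x"
      using mean_abs_le_depth by blast
    also have "\<dots> \<le> (SUP L. ennreal (C * depth 0 L x)) * sharp_max f x"
      by (intro mult_right_mono SUP_upper) auto
    finally show "dev Q S \<le> \<dots>" .
  qed
qed

lemma incseq_depth: "incseq (\<lambda>L. depth 0 L x)"
  unfolding depth_def by (intro incseq_SucI) simp

text \<open>Reduces both estimates to bounds uniform in the truncation \<open>L\<close>: the ratio
  is dominated by an increasing limit of measurable functions, to which monotone convergence
  applies.\<close>

lemma ratio_integral_le:
  assumes w [measurable]: "w \<in> borel_measurable lebesgue" and "1 \<le> p"
    and b: "\<And>L. (\<integral>\<^sup>+x. ennreal ((C * depth 0 L x) powr p) * ennreal (w x) \<partial>lebesgue) \<le> b"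
  shows "(\<integral>\<^sup>+x\<in>Q. ennpow (loc_dyadic_max Q (\<lambda>y. f y - avg f Q) x / sharp_max f x) p * ennreal (w x) \<partial>lebesgue) \<le> b"
proof -
  let ?t = "\<lambda>L x. ennreal ((C * depth 0 L x) powr p)"
  have mono: "(C * depth 0 L x) powr p \<le> (C * depth 0 L' x) powr p" if "L \<le> L'" for L L' x
    using that \<open>1 \<le> p\<close> incseq_depth[of x] depth_nonneg[of 0 L x] C_pos
    by (intro powr_mono2) (auto simp: incseq_def)
  have "(\<integral>\<^sup>+x\<in>Q. ennpow (loc_dyadic_max Q (\<lambda>y. f y - avg f Q) x / sharp_max f x) p * ennreal (w x) \<partial>lebesgue)
      \<le> (\<integral>\<^sup>+x. (SUP L. ?t L x * ennreal (w x)) \<partial>lebesgue)"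
  proof (rule nn_integral_mono)
    fix x
    have "ennpow (loc_dyadic_max Q (\<lambda>y. f y - avg f Q) x / sharp_max f x) p \<le> (SUP L. ?t L x)"
      using ratio_le_depth depth_nonneg incseq_depth[of x] \<open>1 \<le> p\<close> C_pos
      by (intro ennpow_le_SUP) (auto simp: incseq_def)
    then have "ennpow (loc_dyadic_max Q (\<lambda>y. f y - avg f Q) x / sharp_max f x) p * ennreal (w x)
        \<le> (SUP L. ?t L x * ennreal (w x))"
      unfolding SUP_mult_right_ennreal[symmetric] by (intro mult_right_mono) auto
    then show "ennpow (loc_dyadic_max Q (\<lambda>y. f y - avg f Q) x / sharp_max f x) p * ennreal (w x) * indicator Q x
        \<le> (SUP L. ?t L x * ennreal (w x))"
      by (auto split: split_indicator)
  qed
  also have "\<dots> = (SUP L. \<integral>\<^sup>+x. ?t L x * ennreal (w x) \<partial>lebesgue)"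
  proof (rule nn_integral_monotone_convergence_SUP)
    show "incseq (\<lambda>L x. ?t L x * ennreal (w x))"
      by (intro incseq_SucI le_funI mult_right_mono ennreal_leI mono) simp_all
  qed measurable
  also have "\<dots> \<le> b" using b by (intro SUP_least)
  finally show ?thesis .
qed

section \<open>The two integral estimates\<close>

lemma weighted_max_le_1:
  "weighted_max lebesgue R x \<le> 1"
  unfolding weighted_max_def
proof (rule SUP_least)
  fix S assume "S \<in> {S \<in> dyadic_desc Q. S \<subseteq> R}"
  then have "emeasure lebesgue S / emeasure lebesgue S = 1"
    using emeasure_pos[of S] emeasure_finite[of S] by (intro ennreal_divide_self) (auto simp: top.not_eq_extremum)
  then show "emeasure lebesgue S / emeasure lebesgue S * indicator S x \<le> 1"
    by (simp split: split_indicator)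
qed

text \<open>For Lebesgue measure all averages equal 1, so the packing constant is 2 and
  \<open>4 * p * 2\<close> gives \<open>8 * p\<close>.\<close>

lemma depth_powr_integral:
  assumes "1 \<le> p"
  shows "(\<integral>\<^sup>+x. ennreal (depth 0 L x powr p) \<partial>lebesgue) \<le> ennreal ((8 * p) powr p) * emeasure lebesgue Q"
proof -
  have "(\<Sum>k=j..<L. emeasure lebesgue (level k)) \<le> ennreal 2 * emeasure lebesgue (level j)" for j
  proof -
    have "(\<integral>\<^sup>+x\<in>R. weighted_max lebesgue R x \<partial>lebesgue) \<le> 1 * emeasure lebesgue R" if "R \<in> dyadic_desc Q" for R
    proof -
      have "(\<integral>\<^sup>+x\<in>R. weighted_max lebesgue R x \<partial>lebesgue) \<le> (\<integral>\<^sup>+x. indicator R x \<partial>lebesgue)"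
        using weighted_max_le_1 by (intro nn_integral_mono) (auto split: split_indicator)
      also have "\<dots> = 1 * emeasure lebesgue R"
        using sets_D[OF that] by (simp only: nn_integral_indicator mult_1)
      finally show ?thesis .
    qed
    then show ?thesis
      using sum_level_le[of "\<lambda>_. 1" 1 j L] by (simp only: density_1 borel_measurable_const) simp
  qed
  then show ?thesis
    using depth_powr_moment[of "\<lambda>_. 1" L 2 p] assms
    by (simp only: density_1 borel_measurable_const) (simp add: mult.commute)
qed

text \<open>Young's inequality with exponents \<open>s = r / (r - 1)\<close> and \<open>r\<close> is
  applied to \<open>(depth / K) powr p\<close> and \<open>w / W\<close>. Here
  \<open>K = 8 * q\<close> is the scale of the unweighted moment of order \<open>q = p * s\<close>,
  and \<open>W\<close> is the \<open>r\<close>-th power mean of \<open>w\<close> over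
  \<open>Q\<close>. With these scalings both integrals are at most the measure of \<open>Q\<close>,
  and \<open>1 / s + 1 / r = 1\<close> leaves no further constant.\<close>

lemma ratio_integral_weight_r:
  assumes w: "is_weight w" and "1 \<le> p" "1 < r"
  shows "(\<integral>\<^sup>+x\<in>Q. ennpow (loc_dyadic_max Q (\<lambda>y. f y - avg f Q) x / sharp_max f x) p * ennreal (w x) \<partial>lebesgue)
    \<le> ennreal ((8 * C * p * (r / (r - 1))) powr p) * w_r w r Q"
proof -
  have [measurable]: "w \<in> borel_measurable lebesgue" and w0: "\<And>x. 0 \<le> w x"
    using w by (auto simp: is_weight_def locally_integrable_def)
  have Q_sets [measurable]: "Q \<in> sets lebesgue" using Q_cube by simp
  define s where "s = r / (r - 1)"
  have s: "1 < s" "1 / s + 1 / r = 1" using \<open>1 < r\<close> by (auto simp: s_def field_simps)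
  let ?m = "measure lebesgue Q" and ?I = "\<integral>\<^sup>+x\<in>Q. ennreal (w x powr r) \<partial>lebesgue"
  have m: "0 < ?m" using is_cube_measure_pos[OF Q_cube] .
  define q where "q = p * s"
  have "1 * 1 \<le> p * s" using s \<open>1 \<le> p\<close> by (intro mult_mono) auto
  then have q: "1 \<le> q" by (simp add: q_def)
  define K where "K = 8 * q"
  have K: "0 < K" using q by (simp add: K_def)
  have CK: "(8 * C * p * (r / (r - 1))) powr p = C powr p * K powr p"
    using C_pos K by (simp add: K_def q_def s_def[symmetric] powr_mult[symmetric] mult_ac)
  have Cpow: "(C * depth 0 L x) powr p = C powr p * depth 0 L x powr p" for L x
    using C_pos depth_nonneg by (simp add: powr_mult)
  show ?thesis
  proof (cases "?I = top")
    case True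
    then have "w_r w r Q = top"
      using m by (simp add: w_r_def ennpow_def ennreal_mult_top)
    moreover have "ennreal ((8 * C * p * (r / (r - 1))) powr p) \<noteq> 0"
      unfolding CK using C_pos K by simp
    ultimately show ?thesis by (simp add: ennreal_mult_top)
  next
    case I_fin: False
    then obtain i where i: "?I = ennreal i" "0 \<le> i" by (cases ?I) auto
    have "(\<integral>\<^sup>+x. ennreal ((C * depth 0 L x) powr p) * ennreal (w x) \<partial>lebesgue)
        \<le> ennreal ((8 * C * p * (r / (r - 1))) powr p) * w_r w r Q" for L
    \<comment> \<open>Division by \<open>W\<close> requires \<open>0 < i\<close>. If
      \<open>i = 0\<close>, then \<open>w\<close> vanishes almost everywhere on \<open>Q\<close>,
      while the depth vanishes off \<open>Q\<close>.\<close>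
    proof (cases "i = 0")
      case True
      then have "AE x in lebesgue. ennreal (w x powr r) * indicator Q x = 0"
        using i by (subst nn_integral_0_iff_AE[symmetric]) auto
      then have "AE x in lebesgue. ennreal ((C * depth 0 L x) powr p) * ennreal (w x) = 0"
      proof eventually_elim
        case (elim x)
        then show ?case
          using depth_outside[of x 0 L] w0[of x] by (cases "x \<in> Q") auto
      qed
      then have "(\<integral>\<^sup>+x. ennreal ((C * depth 0 L x) powr p) * ennreal (w x) \<partial>lebesgue) = 0"
        by (subst nn_integral_0_iff_AE) auto
      then show ?thesis by simp
    next
      case False
      with i have "0 < i" by simp
      define W where "W = (i / ?m) powr (1 / r)"
      have W: "0 < W" "W powr r = i / ?m"
        using \<open>0 < i\<close> m \<open>1 < r\<close> by (auto simp: W_def powr_powr)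
      have w_r_eq: "w_r w r Q = ennreal (?m * W)"
        unfolding w_r_def i(1) using m \<open>0 < i\<close>
        by (simp add: ennpow_def W_def ennreal_mult flip: ennreal_mult)
      have point: "depth 0 L x powr p * w x \<le> K powr p * W / s / K powr q * depth 0 L x powr q
          + K powr p * W / r / W powr r * w x powr r" for x
      proof -
        let ?t = "depth 0 L x"
        have "(?t / K) powr p * (w x / W) \<le> ((?t / K) powr p) powr s / s + (w x / W) powr r / r"
          using s \<open>1 < r\<close> w0 W K depth_nonneg[of 0 L x] by (intro Youngs_inequality) auto
        also have "\<dots> = ?t powr q / K powr q / s + w x powr r / W powr r / r"
          using w0 W K depth_nonneg[of 0 L x] by (simp add: powr_powr powr_divide q_def)
        finally have "K powr p * W * ((?t / K) powr p * (w x / W))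
            \<le> K powr p * W * (?t powr q / K powr q / s + w x powr r / W powr r / r)"
          using W by (intro mult_left_mono) auto
        moreover have "K powr p * W * ((?t / K) powr p * (w x / W)) = ?t powr p * w x"
          using W K depth_nonneg[of 0 L x] by (simp add: powr_divide)
        ultimately show ?thesis by (simp add: algebra_simps)
      qed
      let ?a = "K powr p * W / s / K powr q" and ?b = "K powr p * W / r / W powr r"
      have ab: "0 \<le> ?a" "0 \<le> ?b" using W(1) s \<open>1 < r\<close> by auto
      have "(\<integral>\<^sup>+x. ennreal (depth 0 L x powr p * w x) \<partial>lebesgue)
          \<le> (\<integral>\<^sup>+x. ennreal ?a * ennreal (depth 0 L x powr q) + ennreal ?b * (ennreal (w x powr r) * indicator Q x) \<partial>lebesgue)"
      proof (rule nn_integral_mono)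
        fix x
        show "ennreal (depth 0 L x powr p * w x)
          \<le> ennreal ?a * ennreal (depth 0 L x powr q) + ennreal ?b * (ennreal (w x powr r) * indicator Q x)"
        proof (cases "x \<in> Q")
          case True
          have "ennreal (depth 0 L x powr p * w x) \<le> ennreal (?a * depth 0 L x powr q + ?b * w x powr r)"
            by (intro ennreal_leI point)
          also have "\<dots> = ennreal ?a * ennreal (depth 0 L x powr q) + ennreal ?b * ennreal (w x powr r)"
            using ab by (simp add: ennreal_plus ennreal_mult del: times_divide_eq_left times_divide_eq_right divide_divide_eq_left)
          finally show ?thesis using True by simp
        next
          case False
          then show ?thesis using depth_outside[of x 0 L] by simp
        qed
      qed
      also have "\<dots> = ennreal ?a * (\<integral>\<^sup>+x. ennreal (depth 0 L x powr q) \<partial>lebesgue) + ennreal ?b * ?I"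
        by (subst nn_integral_add) (auto simp: nn_integral_cmult)
      also have "\<dots> \<le> ennreal ?a * ennreal (K powr q * ?m) + ennreal ?b * ennreal i"
        unfolding i(1) using depth_powr_integral[OF q, of L]
        by (intro add_mono mult_left_mono) (auto simp: K_def emeasure_is_cube[OF Q_cube] ennreal_mult)
      also have "\<dots> = ennreal (?a * (K powr q * ?m) + ?b * i)"
        using ab m i by (simp add: ennreal_plus ennreal_mult del: times_divide_eq_left times_divide_eq_right divide_divide_eq_left)
      also have "?a * (K powr q * ?m) + ?b * i = K powr p * (?m * W) * (1 / s + 1 / r)"
        unfolding W(2) using K m \<open>0 < i\<close> s \<open>1 < r\<close> by (simp add: field_simps)
      also have "\<dots> = K powr p * (?m * W)" using s by simp
      finally have *: "(\<integral>\<^sup>+x. ennreal (depth 0 L x powr p * w x) \<partial>lebesgue) \<le> ennreal (K powr p * (?m * W))" .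
      have "(\<integral>\<^sup>+x. ennreal ((C * depth 0 L x) powr p) * ennreal (w x) \<partial>lebesgue)
          = (\<integral>\<^sup>+x. ennreal (C powr p) * ennreal (depth 0 L x powr p * w x) \<partial>lebesgue)"
        unfolding Cpow using w0 by (intro nn_integral_cong) (simp add: ennreal_mult mult.assoc)
      also have "\<dots> = ennreal (C powr p) * (\<integral>\<^sup>+x. ennreal (depth 0 L x powr p * w x) \<partial>lebesgue)"
        by (intro nn_integral_cmult) measurable
      also have "\<dots> \<le> ennreal (C powr p) * ennreal (K powr p * (?m * W))"
        using * by (intro mult_left_mono) auto
      also have "\<dots> = ennreal ((8 * C * p * (r / (r - 1))) powr p) * w_r w r Q"
        unfolding CK w_r_eq using m W by (simp add: ennreal_mult mult.assoc)
      finally show ?thesis .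
    qed
    then show ?thesis
      using \<open>1 \<le> p\<close> by (intro ratio_integral_le) auto
  qed
qed

lemma weighted_max_le_hl_max:
  assumes [measurable]: "w \<in> borel_measurable lebesgue" and w0: "\<And>x. 0 \<le> w x" and R: "R \<in> dyadic_desc Q"
  shows "weighted_max (density lebesgue (\<lambda>x. ennreal (w x))) R x \<le> hl_max (\<lambda>y. w y * indicator R y) x"
  unfolding weighted_max_def
proof (rule SUP_least)
  let ?N = "density lebesgue (\<lambda>x. ennreal (w x))"
  fix S assume "S \<in> {S \<in> dyadic_desc Q. S \<subseteq> R}"
  then have S: "is_cube S" "S \<subseteq> R" using desc_is_cube by auto
  show "emeasure ?N S / emeasure lebesgue S * indicator S x \<le> hl_max (\<lambda>y. w y * indicator R y) x"
  proof (cases "x \<in> S")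
    case True
    have [measurable]: "R \<in> sets lebesgue" "S \<in> sets lebesgue" using sets_D[OF R] S by auto
    have "emeasure ?N S = emeasure (density lebesgue (\<lambda>y. ennreal \<bar>w y * indicator R y\<bar>)) S"
      using S(2) w0 by (simp add: emeasure_density) (auto intro!: nn_integral_cong split: split_indicator)
    then have "emeasure ?N S / emeasure lebesgue S = mean_abs (\<lambda>y. w y * indicator R y) S"
      by (subst mean_abs_eq_divide[OF S(1)]) auto
    also have "\<dots> \<le> hl_max (\<lambda>y. w y * indicator R y) x"
      unfolding hl_max_def using S True by (intro SUP_upper) auto
    finally show ?thesis using True by simp
  qed simp
qed

text \<open>The A-infinity constant \<open>a\<close> bounds the integrated maximal function on every
  dyadic cube, so the packing constant is \<open>2 * a\<close> and the moment bound
  \<open>4 * p * (2 * a)\<close> applies directly to the measure with density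
  \<open>w\<close>.\<close>

lemma ratio_integral_A_infinity:
  assumes w: "is_weight w" and A: "Ainf_const w < top" and "1 \<le> p"
  shows "(\<integral>\<^sup>+x\<in>Q. ennpow (loc_dyadic_max Q (\<lambda>y. f y - avg f Q) x / sharp_max f x) p * ennreal (w x) \<partial>lebesgue)
    \<le> ennreal ((8 * C * p * enn2real (Ainf_const w)) powr p) * wmeas w Q"
proof -
  have [measurable]: "w \<in> borel_measurable lebesgue" and w0: "\<And>x. 0 \<le> w x"
    using w by (auto simp: is_weight_def locally_integrable_def)
  let ?N = "density lebesgue (\<lambda>x. ennreal (w x))"
  define a where "a = enn2real (Ainf_const w)"
  have a: "0 \<le> a" "Ainf_const w = ennreal a" using A by (auto simp: a_def)
  have wmeas: "wmeas w R = emeasure ?N R" if "is_cube R" for R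
    using that by (simp add: wmeas_def emeasure_density)
  have A_inf: "(\<integral>\<^sup>+x\<in>R. weighted_max ?N R x \<partial>lebesgue) \<le> ennreal a * emeasure ?N R" if R: "R \<in> dyadic_desc Q" for R
  proof -
    let ?h = "\<integral>\<^sup>+x\<in>R. hl_max (\<lambda>y. w y * indicator R y) x \<partial>lebesgue"
    have cube: "is_cube R" using desc_is_cube[OF R] .
    have le: "?h / wmeas w R \<le> ennreal a"
      unfolding a(2)[symmetric] Ainf_const_def using cube by (intro SUP_upper) auto
    have "wmeas w R < top"
    proof -
      have "set_integrable lebesgue R w"
        using w is_cube_compact[OF cube] by (auto simp: is_weight_def locally_integrable_def)
      then have "(\<integral>\<^sup>+x. ennreal (norm (indicator R x *\<^sub>R w x)) \<partial>lebesgue) < \<infinity>"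
        unfolding set_integrable_def by (simp add: integrable_iff_bounded)
      also have "(\<integral>\<^sup>+x. ennreal (norm (indicator R x *\<^sub>R w x)) \<partial>lebesgue) = wmeas w R"
        unfolding wmeas_def using w0 by (intro nn_integral_cong) (auto split: split_indicator)
      finally show ?thesis by simp
    qed
    have "?h \<le> ennreal a * wmeas w R"
    \<comment> \<open>A nonzero extended real divided by 0 is \<open>top\<close>, so the finite
      bound on the quotient forces \<open>?h = 0\<close> when the mass vanishes.\<close>
    proof (cases "wmeas w R = 0")
      case True
      then have "?h = 0" using le by (auto split: if_splits simp: top_unique)
      then show ?thesis by simp
    next
      case False
      then have "?h = ?h / wmeas w R * wmeas w R"
        using \<open>wmeas w R < top\<close> by (subst ennreal_divide_mult_cancel) auto
      also have "\<dots> \<le> ennreal a * wmeas w R" using le by (intro mult_right_mono) auto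
      finally show ?thesis .
    qed
    moreover have "(\<integral>\<^sup>+x\<in>R. weighted_max ?N R x \<partial>lebesgue) \<le> ?h"
      using weighted_max_le_hl_max[OF _ w0 R] by (intro nn_integral_mono mult_right_mono) auto
    ultimately show ?thesis by (simp add: wmeas[OF cube])
  qed
  have sum_le: "(\<Sum>k=j..<L. emeasure ?N (level k)) \<le> ennreal (2 * a) * emeasure ?N (level j)" for j L
    using sum_level_le[OF _ A_inf, of j L] a(1) by (simp add: ennreal_mult)
  have "(\<integral>\<^sup>+x. ennreal (depth 0 L x powr p) \<partial>?N) \<le> ennreal ((8 * p * a) powr p) * emeasure ?N Q" for L
  \<comment> \<open>The moment lemma asks for a positive constant. If \<open>a = 0\<close>, packing
    from level 0 shows that \<open>Q\<close> has mass 0, so the constant 1 serves and both sides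
    vanish.\<close>
  proof (cases "a = 0")
    case True
    then have "emeasure ?N Q = 0" using sum_le[of 0 1] by simp
    moreover have "(\<Sum>k=j..<L. emeasure ?N (level k)) \<le> ennreal 1 * emeasure ?N (level j)" for j
    proof -
      have "(\<Sum>k=j..<L. emeasure ?N (level k)) \<le> 0" using sum_le[of j L] True by simp
      then show ?thesis by (simp add: order_trans[OF _ zero_le])
    qed
    then have "(\<integral>\<^sup>+x. ennreal (depth 0 L x powr p) \<partial>?N) \<le> ennreal ((4 * p * 1) powr p) * emeasure ?N Q"
      using \<open>1 \<le> p\<close> by (intro depth_powr_moment) auto
    ultimately show ?thesis by simp
  next
    case False
    with a have "0 < a" by simp
    then have "(\<integral>\<^sup>+x. ennreal (depth 0 L x powr p) \<partial>?N) \<le> ennreal ((4 * p * (2 * a)) powr p) * emeasure ?N Q"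
      using \<open>1 \<le> p\<close> sum_le by (intro depth_powr_moment) auto
    then show ?thesis by (simp add: mult_ac)
  qed
  then have moment: "(\<integral>\<^sup>+x. ennreal (w x) * ennreal (depth 0 L x powr p) \<partial>lebesgue) \<le> ennreal ((8 * p * a) powr p) * wmeas w Q" for L
    by (simp add: nn_integral_density wmeas[OF Q_cube])
  have "(\<integral>\<^sup>+x. ennreal ((C * depth 0 L x) powr p) * ennreal (w x) \<partial>lebesgue)
      \<le> ennreal ((8 * C * p * a) powr p) * wmeas w Q" for L
  proof -
    have "(\<integral>\<^sup>+x. ennreal ((C * depth 0 L x) powr p) * ennreal (w x) \<partial>lebesgue)
        = (\<integral>\<^sup>+x. ennreal (C powr p) * (ennreal (w x) * ennreal (depth 0 L x powr p)) \<partial>lebesgue)"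
      using C_pos depth_nonneg by (intro nn_integral_cong) (simp add: powr_mult ennreal_mult mult_ac)
    also have "\<dots> = ennreal (C powr p) * (\<integral>\<^sup>+x. ennreal (w x) * ennreal (depth 0 L x powr p) \<partial>lebesgue)"
      by (intro nn_integral_cmult) measurable
    also have "\<dots> \<le> ennreal (C powr p) * (ennreal ((8 * p * a) powr p) * wmeas w Q)"
      by (intro mult_left_mono moment) auto
    also have "\<dots> = ennreal (C powr p * (8 * p * a) powr p) * wmeas w Q"
      by (simp add: ennreal_mult mult.assoc)
    also have "C powr p * (8 * p * a) powr p = (8 * C * p * a) powr p"
      using C_pos a \<open>1 \<le> p\<close> by (simp add: powr_mult[symmetric] mult_ac)
    finally show ?thesis .
  qed
  then show ?thesis
    unfolding a_def[symmetric] using \<open>1 \<le> p\<close> by (intro ratio_integral_le) auto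
qed

end

text \<open>The estimates are raised to the power \<open>p\<close> and multiplied by the normalizing
  mass, so a vanishing or infinite mass never appears in a denominator.\<close>

theorem theorem1p1:
  shows "(\<exists>c::real. c > 0 \<and>
     (\<forall>(f::real^'n \<Rightarrow> real) w Q p r.
        locally_integrable f \<longrightarrow> is_weight w \<longrightarrow> is_cube Q \<longrightarrow> 1 \<le> p \<longrightarrow> 1 < r \<longrightarrow>
        (\<integral>\<^sup>+ x\<in>Q. ennpow (loc_dyadic_max Q (\<lambda>y. f y - avg f Q) x / sharp_max f x) p
                      * ennreal (w x) \<partial>lebesgue)
          \<le> ennreal ((c * p * (r / (r - 1))) powr p) * w_r w r Q))
   \<and> (\<exists>c::real. c > 0 \<and>
     (\<forall>(f::real^'n \<Rightarrow> real) w Q p.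
        locally_integrable f \<longrightarrow> is_weight w \<longrightarrow> Ainf_const w < top \<longrightarrow>
        is_cube Q \<longrightarrow> 1 \<le> p \<longrightarrow>
        (\<integral>\<^sup>+ x\<in>Q. ennpow (loc_dyadic_max Q (\<lambda>y. f y - avg f Q) x / sharp_max f x) p
                      * ennreal (w x) \<partial>lebesgue)
          \<le> ennreal ((c * p * enn2real (Ainf_const w)) powr p) * wmeas w Q))"
proof -
  define C :: real where "C = 4 * 2 ^ CARD('n)"
  have loc: "dyadic_oscillation f Q C" if "locally_integrable f" "is_cube Q" for f :: "real^'n \<Rightarrow> real" and Q
    using that by unfold_locales (simp_all add: C_def)
  \<comment> \<open>The common constant \<open>8 * C\<close> equals \<open>32 * 2 ^ CARD('n)\<close>
    and depends on the dimension alone.\<close>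
  have "0 < 8 * C" by (simp add: C_def)
  then show ?thesis
    using dyadic_oscillation.ratio_integral_weight_r[OF loc] dyadic_oscillation.ratio_integral_A_infinity[OF loc]
    by (intro conjI exI[of _ "8 * C"] allI impI) simp_all
qed

end
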